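(* Let $\mathcal{C}$ be a Frobenius extriangulated category with subcategory $\mathcal{P}$ of projective-injective objects, and let $\mathcal{X}\subseteq\mathcal{C}$ be a rigid and functorially finite subcategory such that $\mathcal{X}^{\perp_1}={}^{\perp_1}\mathcal{X}$. Then $\mathcal{X}^{\perp_1}$ is also a Frobenius extriangulated category, with projective-injectives $\mathrm{add}(\mathcal{X},\mathcal{P})$. If $\mathcal{C}$ is weakly idempotent complete, then so is $\mathcal{X}^{\perp_1}$.
   Context: Let $\mathbb{K}$ be a field. An extriangulated category (Nakaoka--Palu) $(\mathcal{C},\mathbb{E}_{\mathcal{C}},\mathfrak{s})$ consists of a $\mathbb{K}$-linear additive category, a $\mathbb{K}$-bilinear bifunctor $\mathbb{E}_{\mathcal{C}}\colon\mathcal{C}^{\mathrm{op}}\times\mathcal{C}\to\{\mathbb{K}\text{-modules}\}$, and an additive realisation $\mathfrak{s}$ sending $\delta\in\mathbb{E}_{\mathcal{C}}(C,A)$ to an equivalence class of sequences $A\to B\to C$ (conflations; first maps are inflations, second maps deflations), satisfying (ET3), (ET3)$^{\mathrm{op}}$, (ET4), (ET4)$^{\mathrm{op}}$. Extension-closed full subcategories inherit an extriangulated structure by restriction of $\mathbb{E}_{\mathcal C}$ and $\mathfrak{s}$. An object $P$ is projective if $\mathrm{Hom}(P,g)$ is surjective for every deflation $g$ and injective if $\mathrm{Hom}(f,P)$ is surjective for every inflation $f$. $\mathcal{C}$ is Frobenius if each object $X$ admits a deflation $P\to X$ with $P$ projective and an inflation $X\to I$ with $I$ injective, and an object is projective if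 and only if it is injective. Subcategories are full. $\mathcal{X}^{\perp_1}=\{Y\in\mathcal C:\mathbb{E}_{\mathcal{C}}(X,Y)=0\ \forall X\in\mathcal{X}\}$ and ${}^{\perp_1}\mathcal{X}=\{Y\in\mathcal C:\mathbb{E}_{\mathcal{C}}(Y,X)=0\ \forall X\in\mathcal{X}\}$; both are extension-closed in $\mathcal{C}$. $\mathcal{X}$ is rigid if $\mathcal{X}\subseteq\mathcal{X}^{\perp_1}$, and functorially finite if every object of $\mathcal{C}$ has a left and a right $\mathcal{X}$-approximation. $\mathrm{add}(\mathcal{X},\mathcal{P})$ is the smallest full subcategory containing $\mathcal{X}$ and $\mathcal{P}$ and closed under finite direct sums and direct summands. An additive category is weakly idempotent complete if every retraction has a kernel. *)

theory Defs
  imports "HOL-Algebra.Module"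
begin

section \<open>Linear and additive categories\<close>

text \<open>
  A category has a set \<open>Obj\<close> of objects; \<open>Hom \<C> A B\<close> is the \<open>K\<close>-module of morphisms
  \<open>A \<rightarrow> B\<close>. Only \<open>carrier\<close>, \<open>zero\<close>, \<open>add\<close> and \<open>smult\<close> of the record type \<^typ>\<open>('k, 'm) module\<close>
  are meaningful here (its fields \<open>mult\<close> and \<open>one\<close> are not used).
  Composition and, below, the actions of morphisms on extensions are not indexed by objects; any
  category can be brought into this form by tagging morphisms with domain and codomain.
  What the record fields do outside \<open>Obj\<close> is irrelevant.
\<close>

record ('o, 'm, 'k) linear_cat =
  Obj :: "'o set"
  Hom :: "'o \<Rightarrow> 'o \<Rightarrow> ('k, 'm) module"
  Id :: "'o \<Rightarrow> 'm"
  Comp :: "'m \<Rightarrow> 'm \<Rightarrow> 'm"  (infixl \<open>\<cdot>\<index>\<close> 75)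

abbreviation mor :: "('o, 'm, 'k, 'z) linear_cat_scheme \<Rightarrow> 'o \<Rightarrow> 'o \<Rightarrow> 'm set" where
  "mor \<C> A B \<equiv> carrier (Hom \<C> A B)"

definition zero_object :: "('o, 'm, 'k, 'z) linear_cat_scheme \<Rightarrow> 'o \<Rightarrow> bool" where
  "zero_object \<C> Z \<longleftrightarrow> Z \<in> Obj \<C> \<and>
     (\<forall>A\<in>Obj \<C>. (\<exists>!f. f \<in> mor \<C> Z A) \<and> (\<exists>!f. f \<in> mor \<C> A Z))"

text \<open>\<open>biproduct \<C> A B S i j p q\<close>: the object \<open>S\<close>, with injections \<open>i\<close>, \<open>j\<close> and projections
  \<open>p\<close>, \<open>q\<close>, is a direct sum of \<open>A\<close> and \<open>B\<close>.\<close>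

definition biproduct ::
  "('o, 'm, 'k, 'z) linear_cat_scheme \<Rightarrow> 'o \<Rightarrow> 'o \<Rightarrow> 'o \<Rightarrow> 'm \<Rightarrow> 'm \<Rightarrow> 'm \<Rightarrow> 'm \<Rightarrow> bool" where
  "biproduct \<C> A B S i j p q \<longleftrightarrow>
     A \<in> Obj \<C> \<and> B \<in> Obj \<C> \<and> S \<in> Obj \<C> \<and>
     i \<in> mor \<C> A S \<and> j \<in> mor \<C> B S \<and> p \<in> mor \<C> S A \<and> q \<in> mor \<C> S B \<and>
     p \<cdot>\<^bsub>\<C>\<^esub> i = Id \<C> A \<and> q \<cdot>\<^bsub>\<C>\<^esub> j = Id \<C> B \<and>
     p \<cdot>\<^bsub>\<C>\<^esub> j = \<zero>\<^bsub>Hom \<C> B A\<^esub> \<and> q \<cdot>\<^bsub>\<C>\<^esub> i = \<zero>\<^bsub>Hom \<C> A B\<^esub> \<and>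
     (i \<cdot>\<^bsub>\<C>\<^esub> p) \<oplus>\<^bsub>Hom \<C> S S\<^esub> (j \<cdot>\<^bsub>\<C>\<^esub> q) = Id \<C> S"

definition direct_sum :: "('o, 'm, 'k, 'z) linear_cat_scheme \<Rightarrow> 'o \<Rightarrow> 'o \<Rightarrow> 'o \<Rightarrow> bool" where
  "direct_sum \<C> A B S \<longleftrightarrow> (\<exists>i j p q. biproduct \<C> A B S i j p q)"

locale linear_category = K: field K for K :: "'k ring" +
  fixes \<C> :: "('o, 'm, 'k, 'z) linear_cat_scheme" (structure)
  assumes Hom_module: "\<lbrakk>A \<in> Obj \<C>; B \<in> Obj \<C>\<rbrakk> \<Longrightarrow> module K (Hom \<C> A B)"
    and Id_in: "A \<in> Obj \<C> \<Longrightarrow> Id \<C> A \<in> mor \<C> A A"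
    and Comp_in: "\<lbrakk>A \<in> Obj \<C>; B \<in> Obj \<C>; C \<in> Obj \<C>; f \<in> mor \<C> A B; g \<in> mor \<C> B C\<rbrakk>
      \<Longrightarrow> g \<cdot> f \<in> mor \<C> A C"
    and Id_left: "\<lbrakk>A \<in> Obj \<C>; B \<in> Obj \<C>; f \<in> mor \<C> A B\<rbrakk> \<Longrightarrow> Id \<C> B \<cdot> f = f"
    and Id_right: "\<lbrakk>A \<in> Obj \<C>; B \<in> Obj \<C>; f \<in> mor \<C> A B\<rbrakk> \<Longrightarrow> f \<cdot> Id \<C> A = f"
    and Comp_assoc:
      "\<lbrakk>A \<in> Obj \<C>; B \<in> Obj \<C>; C \<in> Obj \<C>; D \<in> Obj \<C>;
        f \<in> mor \<C> A B; g \<in> mor \<C> B C; h \<in> mor \<C> C D\<rbrakk>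
       \<Longrightarrow> (h \<cdot> g) \<cdot> f = h \<cdot> (g \<cdot> f)"
    and Comp_add_left:
      "\<lbrakk>A \<in> Obj \<C>; B \<in> Obj \<C>; C \<in> Obj \<C>; f \<in> mor \<C> A B; g \<in> mor \<C> B C; g' \<in> mor \<C> B C\<rbrakk>
       \<Longrightarrow> (g \<oplus>\<^bsub>Hom \<C> B C\<^esub> g') \<cdot> f = (g \<cdot> f) \<oplus>\<^bsub>Hom \<C> A C\<^esub> (g' \<cdot> f)"
    and Comp_add_right:
      "\<lbrakk>A \<in> Obj \<C>; B \<in> Obj \<C>; C \<in> Obj \<C>; f \<in> mor \<C> A B; f' \<in> mor \<C> A B; g \<in> mor \<C> B C\<rbrakk>
       \<Longrightarrow> g \<cdot> (f \<oplus>\<^bsub>Hom \<C> A B\<^esub> f') = (g \<cdot> f) \<oplus>\<^bsub>Hom \<C> A C\<^esub> (g \<cdot> f')"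
    and Comp_smult_left:
      "\<lbrakk>A \<in> Obj \<C>; B \<in> Obj \<C>; C \<in> Obj \<C>; k \<in> carrier K; f \<in> mor \<C> A B; g \<in> mor \<C> B C\<rbrakk>
       \<Longrightarrow> (k \<odot>\<^bsub>Hom \<C> B C\<^esub> g) \<cdot> f = k \<odot>\<^bsub>Hom \<C> A C\<^esub> (g \<cdot> f)"
    and Comp_smult_right:
      "\<lbrakk>A \<in> Obj \<C>; B \<in> Obj \<C>; C \<in> Obj \<C>; k \<in> carrier K; f \<in> mor \<C> A B; g \<in> mor \<C> B C\<rbrakk>
       \<Longrightarrow> g \<cdot> (k \<odot>\<^bsub>Hom \<C> A B\<^esub> f) = k \<odot>\<^bsub>Hom \<C> A C\<^esub> (g \<cdot> f)"

locale additive_category = linear_category +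
  assumes ex_zero_object: "\<exists>Z. zero_object \<C> Z"
    and ex_direct_sum: "\<lbrakk>A \<in> Obj \<C>; B \<in> Obj \<C>\<rbrakk> \<Longrightarrow> \<exists>S. direct_sum \<C> A B S"

definition isomorphism :: "('o, 'm, 'k, 'z) linear_cat_scheme \<Rightarrow> 'o \<Rightarrow> 'o \<Rightarrow> 'm \<Rightarrow> bool" where
  "isomorphism \<C> A B f \<longleftrightarrow> f \<in> mor \<C> A B \<and>
     (\<exists>g\<in>mor \<C> B A. g \<cdot>\<^bsub>\<C>\<^esub> f = Id \<C> A \<and> f \<cdot>\<^bsub>\<C>\<^esub> g = Id \<C> B)"

definition retraction :: "('o, 'm, 'k, 'z) linear_cat_scheme \<Rightarrow> 'o \<Rightarrow> 'o \<Rightarrow> 'm \<Rightarrow> bool" where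
  "retraction \<C> A B r \<longleftrightarrow> r \<in> mor \<C> A B \<and> (\<exists>s\<in>mor \<C> B A. r \<cdot>\<^bsub>\<C>\<^esub> s = Id \<C> B)"

definition is_kernel ::
  "('o, 'm, 'k, 'z) linear_cat_scheme \<Rightarrow> 'o \<Rightarrow> 'o \<Rightarrow> 'm \<Rightarrow> 'o \<Rightarrow> 'm \<Rightarrow> bool" where
  "is_kernel \<C> A B f N n \<longleftrightarrow> N \<in> Obj \<C> \<and> n \<in> mor \<C> N A \<and> f \<cdot>\<^bsub>\<C>\<^esub> n = \<zero>\<^bsub>Hom \<C> N B\<^esub> \<and>
     (\<forall>T\<in>Obj \<C>. \<forall>t\<in>mor \<C> T A. f \<cdot>\<^bsub>\<C>\<^esub> t = \<zero>\<^bsub>Hom \<C> T B\<^esub> \<longrightarrow>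
        (\<exists>!u. u \<in> mor \<C> T N \<and> n \<cdot>\<^bsub>\<C>\<^esub> u = t))"

definition weakly_idempotent_complete :: "('o, 'm, 'k, 'z) linear_cat_scheme \<Rightarrow> bool" where
  "weakly_idempotent_complete \<C> \<longleftrightarrow>
     (\<forall>A\<in>Obj \<C>. \<forall>B\<in>Obj \<C>. \<forall>r. retraction \<C> A B r \<longrightarrow> (\<exists>N n. is_kernel \<C> A B r N n))"

text \<open>
  A full subcategory is given by its set of objects. The closure below is also closed under
  isomorphism: if \<open>A'\<close> is isomorphic to \<open>A\<close>, it is a direct sum of \<open>A\<close> and a zero object.
\<close>

inductive_set add_closure :: "('o, 'm, 'k, 'z) linear_cat_scheme \<Rightarrow> 'o set \<Rightarrow> 'o set"
  for \<C> :: "('o, 'm, 'k, 'z) linear_cat_scheme" and \<S> :: "'o set" where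
  base: "A \<in> \<S> \<Longrightarrow> A \<in> add_closure \<C> \<S>"
| zero: "zero_object \<C> Z \<Longrightarrow> Z \<in> add_closure \<C> \<S>"
| sum: "\<lbrakk>A \<in> add_closure \<C> \<S>; B \<in> add_closure \<C> \<S>; direct_sum \<C> A B S\<rbrakk>
    \<Longrightarrow> S \<in> add_closure \<C> \<S>"
| summand: "\<lbrakk>S \<in> add_closure \<C> \<S>; direct_sum \<C> A B S\<rbrakk> \<Longrightarrow> A \<in> add_closure \<C> \<S>"

definition right_approximation ::
  "('o, 'm, 'k, 'z) linear_cat_scheme \<Rightarrow> 'o set \<Rightarrow> 'o \<Rightarrow> 'o \<Rightarrow> 'm \<Rightarrow> bool" where
  "right_approximation \<C> \<X> A X f \<longleftrightarrow> X \<in> \<X> \<and> f \<in> mor \<C> X A \<and>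
     (\<forall>X'\<in>\<X>. \<forall>h\<in>mor \<C> X' A. \<exists>u\<in>mor \<C> X' X. f \<cdot>\<^bsub>\<C>\<^esub> u = h)"

definition left_approximation ::
  "('o, 'm, 'k, 'z) linear_cat_scheme \<Rightarrow> 'o set \<Rightarrow> 'o \<Rightarrow> 'o \<Rightarrow> 'm \<Rightarrow> bool" where
  "left_approximation \<C> \<X> A X f \<longleftrightarrow> X \<in> \<X> \<and> f \<in> mor \<C> A X \<and>
     (\<forall>X'\<in>\<X>. \<forall>h\<in>mor \<C> A X'. \<exists>u\<in>mor \<C> X X'. u \<cdot>\<^bsub>\<C>\<^esub> f = h)"

definition functorially_finite :: "('o, 'm, 'k, 'z) linear_cat_scheme \<Rightarrow> 'o set \<Rightarrow> bool" where
  "functorially_finite \<C> \<X> \<longleftrightarrow>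
     (\<forall>A\<in>Obj \<C>. (\<exists>X f. left_approximation \<C> \<X> A X f) \<and> (\<exists>X f. right_approximation \<C> \<X> A X f))"

section \<open>Extriangulated categories\<close>

text \<open>
  \<open>Ext \<C> C A\<close> is the module \<open>\<bbbE>(C, A)\<close>; \<open>push \<C> a \<delta>\<close> is \<open>a\<^sub>*\<delta> = \<bbbE>(C, a)(\<delta>)\<close> and
  \<open>pull \<C> c \<delta>\<close> is \<open>c\<^sup>*\<delta> = \<bbbE>(c, A)(\<delta>)\<close>. The realisation \<open>realis \<C> C A \<delta>\<close> is a class of triples
  \<open>(B, x, y)\<close> standing for sequences \<open>A \<rightarrow> B \<rightarrow> C\<close> with maps \<open>x\<close> and \<open>y\<close>.
\<close>

record ('o, 'm, 'k, 'e) extri_cat = "('o, 'm, 'k) linear_cat" +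
  Ext :: "'o \<Rightarrow> 'o \<Rightarrow> ('k, 'e) module"
  push :: "'m \<Rightarrow> 'e \<Rightarrow> 'e"
  pull :: "'m \<Rightarrow> 'e \<Rightarrow> 'e"
  realis :: "'o \<Rightarrow> 'o \<Rightarrow> 'e \<Rightarrow> ('o \<times> 'm \<times> 'm) set"

abbreviation ext :: "('o, 'm, 'k, 'e, 'z) extri_cat_scheme \<Rightarrow> 'o \<Rightarrow> 'o \<Rightarrow> 'e set" where
  "ext \<C> C A \<equiv> carrier (Ext \<C> C A)"

definition sequences ::
  "('o, 'm, 'k, 'z) linear_cat_scheme \<Rightarrow> 'o \<Rightarrow> 'o \<Rightarrow> ('o \<times> 'm \<times> 'm) set" where
  "sequences \<C> C A = {(B, x, y). B \<in> Obj \<C> \<and> x \<in> mor \<C> A B \<and> y \<in> mor \<C> B C}"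

definition seq_equiv ::
  "('o, 'm, 'k, 'z) linear_cat_scheme \<Rightarrow> 'o \<Rightarrow> 'o \<Rightarrow> (('o \<times> 'm \<times> 'm) \<times> ('o \<times> 'm \<times> 'm)) set" where
  "seq_equiv \<C> C A =
     {((B, x, y), (B', x', y')).
        (B, x, y) \<in> sequences \<C> C A \<and> (B', x', y') \<in> sequences \<C> C A \<and>
        (\<exists>b. isomorphism \<C> B B' b \<and> b \<cdot>\<^bsub>\<C>\<^esub> x = x' \<and> y' \<cdot>\<^bsub>\<C>\<^esub> b = y)}"

text \<open>\<open>conflation \<C> A x B y C \<delta>\<close>: the extension \<open>\<delta> \<in> \<bbbE>(C, A)\<close> is realised by \<open>A \<rightarrow> B \<rightarrow> C\<close>.\<close>

definition conflation ::
  "('o, 'm, 'k, 'e, 'z) extri_cat_scheme \<Rightarrow> 'o \<Rightarrow> 'm \<Rightarrow> 'o \<Rightarrow> 'm \<Rightarrow> 'o \<Rightarrow> 'e \<Rightarrow> bool" where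
  "conflation \<C> A x B y C \<delta> \<longleftrightarrow>
     A \<in> Obj \<C> \<and> C \<in> Obj \<C> \<and> \<delta> \<in> ext \<C> C A \<and> (B, x, y) \<in> realis \<C> C A \<delta>"

definition inflation ::
  "('o, 'm, 'k, 'e, 'z) extri_cat_scheme \<Rightarrow> 'o \<Rightarrow> 'o \<Rightarrow> 'm \<Rightarrow> bool" where
  "inflation \<C> A B x \<longleftrightarrow> (\<exists>C y \<delta>. conflation \<C> A x B y C \<delta>)"

definition deflation ::
  "('o, 'm, 'k, 'e, 'z) extri_cat_scheme \<Rightarrow> 'o \<Rightarrow> 'o \<Rightarrow> 'm \<Rightarrow> bool" where
  "deflation \<C> B C y \<longleftrightarrow> (\<exists>A x \<delta>. conflation \<C> A x B y C \<delta>)"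

text \<open>
  In \<open>realis_sum\<close>, the expression built from \<open>\<delta>\<close> and \<open>\<delta>'\<close> is the extension \<open>\<delta> \<oplus> \<delta>'\<close>, i.e. the
  element of \<open>\<bbbE>(C \<oplus> C', A \<oplus> A')\<close> with components \<open>(\<delta>, 0, 0, \<delta>')\<close>; the middle maps are \<open>x \<oplus> x'\<close>
  and \<open>y \<oplus> y'\<close>. Direct sums are only determined up to isomorphism, so all choices are allowed.
\<close>

locale extriangulated_category = additive_category K \<C>
  for K :: "'k ring" and \<C> :: "('o, 'm, 'k, 'e, 'z) extri_cat_scheme" (structure) +
  assumes Ext_module: "\<lbrakk>C \<in> Obj \<C>; A \<in> Obj \<C>\<rbrakk> \<Longrightarrow> module K (Ext \<C> C A)"
    and push_in:
      "\<lbrakk>A \<in> Obj \<C>; A' \<in> Obj \<C>; C \<in> Obj \<C>; a \<in> mor \<C> A A'; \<delta> \<in> ext \<C> C A\<rbrakk>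
       \<Longrightarrow> push \<C> a \<delta> \<in> ext \<C> C A'"
    and pull_in:
      "\<lbrakk>A \<in> Obj \<C>; C \<in> Obj \<C>; C' \<in> Obj \<C>; c \<in> mor \<C> C' C; \<delta> \<in> ext \<C> C A\<rbrakk>
       \<Longrightarrow> pull \<C> c \<delta> \<in> ext \<C> C' A"
    and push_Id: "\<lbrakk>A \<in> Obj \<C>; C \<in> Obj \<C>; \<delta> \<in> ext \<C> C A\<rbrakk> \<Longrightarrow> push \<C> (Id \<C> A) \<delta> = \<delta>"
    and pull_Id: "\<lbrakk>A \<in> Obj \<C>; C \<in> Obj \<C>; \<delta> \<in> ext \<C> C A\<rbrakk> \<Longrightarrow> pull \<C> (Id \<C> C) \<delta> = \<delta>"
    and push_Comp:
      "\<lbrakk>A \<in> Obj \<C>; A' \<in> Obj \<C>; A'' \<in> Obj \<C>; C \<in> Obj \<C>;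
        a \<in> mor \<C> A A'; a' \<in> mor \<C> A' A''; \<delta> \<in> ext \<C> C A\<rbrakk>
       \<Longrightarrow> push \<C> (a' \<cdot> a) \<delta> = push \<C> a' (push \<C> a \<delta>)"
    and pull_Comp:
      "\<lbrakk>A \<in> Obj \<C>; C \<in> Obj \<C>; C' \<in> Obj \<C>; C'' \<in> Obj \<C>;
        c \<in> mor \<C> C' C; c' \<in> mor \<C> C'' C'; \<delta> \<in> ext \<C> C A\<rbrakk>
       \<Longrightarrow> pull \<C> (c \<cdot> c') \<delta> = pull \<C> c' (pull \<C> c \<delta>)"
    and push_pull:
      "\<lbrakk>A \<in> Obj \<C>; A' \<in> Obj \<C>; C \<in> Obj \<C>; C' \<in> Obj \<C>;
        a \<in> mor \<C> A A'; c \<in> mor \<C> C' C; \<delta> \<in> ext \<C> C A\<rbrakk>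
       \<Longrightarrow> push \<C> a (pull \<C> c \<delta>) = pull \<C> c (push \<C> a \<delta>)"
    and push_add:
      "\<lbrakk>A \<in> Obj \<C>; A' \<in> Obj \<C>; C \<in> Obj \<C>; a \<in> mor \<C> A A'; \<delta> \<in> ext \<C> C A; \<delta>' \<in> ext \<C> C A\<rbrakk>
       \<Longrightarrow> push \<C> a (\<delta> \<oplus>\<^bsub>Ext \<C> C A\<^esub> \<delta>') = push \<C> a \<delta> \<oplus>\<^bsub>Ext \<C> C A'\<^esub> push \<C> a \<delta>'"
    and push_smult:
      "\<lbrakk>A \<in> Obj \<C>; A' \<in> Obj \<C>; C \<in> Obj \<C>; k \<in> carrier K; a \<in> mor \<C> A A'; \<delta> \<in> ext \<C> C A\<rbrakk>
       \<Longrightarrow> push \<C> a (k \<odot>\<^bsub>Ext \<C> C A\<^esub> \<delta>) = k \<odot>\<^bsub>Ext \<C> C A'\<^esub> push \<C> a \<delta>"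
    and pull_add:
      "\<lbrakk>A \<in> Obj \<C>; C \<in> Obj \<C>; C' \<in> Obj \<C>; c \<in> mor \<C> C' C; \<delta> \<in> ext \<C> C A; \<delta>' \<in> ext \<C> C A\<rbrakk>
       \<Longrightarrow> pull \<C> c (\<delta> \<oplus>\<^bsub>Ext \<C> C A\<^esub> \<delta>') = pull \<C> c \<delta> \<oplus>\<^bsub>Ext \<C> C' A\<^esub> pull \<C> c \<delta>'"
    and pull_smult:
      "\<lbrakk>A \<in> Obj \<C>; C \<in> Obj \<C>; C' \<in> Obj \<C>; k \<in> carrier K; c \<in> mor \<C> C' C; \<delta> \<in> ext \<C> C A\<rbrakk>
       \<Longrightarrow> pull \<C> c (k \<odot>\<^bsub>Ext \<C> C A\<^esub> \<delta>) = k \<odot>\<^bsub>Ext \<C> C' A\<^esub> pull \<C> c \<delta>"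
    and add_push:
      "\<lbrakk>A \<in> Obj \<C>; A' \<in> Obj \<C>; C \<in> Obj \<C>; a \<in> mor \<C> A A'; a' \<in> mor \<C> A A'; \<delta> \<in> ext \<C> C A\<rbrakk>
       \<Longrightarrow> push \<C> (a \<oplus>\<^bsub>Hom \<C> A A'\<^esub> a') \<delta> = push \<C> a \<delta> \<oplus>\<^bsub>Ext \<C> C A'\<^esub> push \<C> a' \<delta>"
    and smult_push:
      "\<lbrakk>A \<in> Obj \<C>; A' \<in> Obj \<C>; C \<in> Obj \<C>; k \<in> carrier K; a \<in> mor \<C> A A'; \<delta> \<in> ext \<C> C A\<rbrakk>
       \<Longrightarrow> push \<C> (k \<odot>\<^bsub>Hom \<C> A A'\<^esub> a) \<delta> = k \<odot>\<^bsub>Ext \<C> C A'\<^esub> push \<C> a \<delta>"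
    and add_pull:
      "\<lbrakk>A \<in> Obj \<C>; C \<in> Obj \<C>; C' \<in> Obj \<C>; c \<in> mor \<C> C' C; c' \<in> mor \<C> C' C; \<delta> \<in> ext \<C> C A\<rbrakk>
       \<Longrightarrow> pull \<C> (c \<oplus>\<^bsub>Hom \<C> C' C\<^esub> c') \<delta> = pull \<C> c \<delta> \<oplus>\<^bsub>Ext \<C> C' A\<^esub> pull \<C> c' \<delta>"
    and smult_pull:
      "\<lbrakk>A \<in> Obj \<C>; C \<in> Obj \<C>; C' \<in> Obj \<C>; k \<in> carrier K; c \<in> mor \<C> C' C; \<delta> \<in> ext \<C> C A\<rbrakk>
       \<Longrightarrow> pull \<C> (k \<odot>\<^bsub>Hom \<C> C' C\<^esub> c) \<delta> = k \<odot>\<^bsub>Ext \<C> C' A\<^esub> pull \<C> c \<delta>"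
    and realis_class:
      "\<lbrakk>A \<in> Obj \<C>; C \<in> Obj \<C>; \<delta> \<in> ext \<C> C A\<rbrakk>
       \<Longrightarrow> realis \<C> C A \<delta> \<in> sequences \<C> C A // seq_equiv \<C> C A"
    and realis_morphism:
      "\<lbrakk>conflation \<C> A x B y C \<delta>; conflation \<C> A' x' B' y' C' \<delta>';
        a \<in> mor \<C> A A'; c \<in> mor \<C> C C'; push \<C> a \<delta> = pull \<C> c \<delta>'\<rbrakk>
       \<Longrightarrow> \<exists>b\<in>mor \<C> B B'. b \<cdot> x = x' \<cdot> a \<and> y' \<cdot> b = c \<cdot> y"
    and realis_zero:
      "biproduct \<C> A C S i j p q \<Longrightarrow> (S, i, q) \<in> realis \<C> C A \<zero>\<^bsub>Ext \<C> C A\<^esub>"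
    and realis_sum:
      "\<lbrakk>conflation \<C> A x B y C \<delta>; conflation \<C> A' x' B' y' C' \<delta>';
        biproduct \<C> A A' SA iA jA pA qA; biproduct \<C> B B' SB iB jB pB qB;
        biproduct \<C> C C' SC iC jC pC qC\<rbrakk>
       \<Longrightarrow> (SB, (iB \<cdot> x \<cdot> pA) \<oplus>\<^bsub>Hom \<C> SA SB\<^esub> (jB \<cdot> x' \<cdot> qA),
                (iC \<cdot> y \<cdot> pB) \<oplus>\<^bsub>Hom \<C> SB SC\<^esub> (jC \<cdot> y' \<cdot> qB))
           \<in> realis \<C> SC SA
               (push \<C> iA (pull \<C> pC \<delta>) \<oplus>\<^bsub>Ext \<C> SC SA\<^esub> push \<C> jA (pull \<C> qC \<delta>'))"
    and ET3:
      "\<lbrakk>conflation \<C> A x B y C \<delta>; conflation \<C> A' x' B' y' C' \<delta>';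
        a \<in> mor \<C> A A'; b \<in> mor \<C> B B'; b \<cdot> x = x' \<cdot> a\<rbrakk>
       \<Longrightarrow> \<exists>c\<in>mor \<C> C C'. c \<cdot> y = y' \<cdot> b \<and> push \<C> a \<delta> = pull \<C> c \<delta>'"
    and ET3_op:
      "\<lbrakk>conflation \<C> A x B y C \<delta>; conflation \<C> A' x' B' y' C' \<delta>';
        b \<in> mor \<C> B B'; c \<in> mor \<C> C C'; c \<cdot> y = y' \<cdot> b\<rbrakk>
       \<Longrightarrow> \<exists>a\<in>mor \<C> A A'. b \<cdot> x = x' \<cdot> a \<and> push \<C> a \<delta> = pull \<C> c \<delta>'"
    and ET4:
      "\<lbrakk>conflation \<C> A f B f' D \<delta>; conflation \<C> B g C g' F \<delta>'\<rbrakk>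
       \<Longrightarrow> \<exists>E d e h' \<delta>''.
             conflation \<C> A (g \<cdot> f) C h' E \<delta>'' \<and>
             conflation \<C> D d E e F (push \<C> f' \<delta>') \<and>
             h' \<cdot> g = d \<cdot> f' \<and> e \<cdot> h' = g' \<and>
             pull \<C> d \<delta>'' = \<delta> \<and> push \<C> f \<delta>'' = pull \<C> e \<delta>'"
    and ET4_op:
      "\<lbrakk>conflation \<C> D f' A f B \<delta>; conflation \<C> F g' B g C \<delta>'\<rbrakk>
       \<Longrightarrow> \<exists>E d e h' \<delta>''.
             conflation \<C> E h' A (g \<cdot> f) C \<delta>'' \<and>
             conflation \<C> D d E e F (pull \<C> g' \<delta>) \<and>
             h' \<cdot> d = f' \<and> f \<cdot> h' = g' \<cdot> e \<and>
             push \<C> e \<delta>'' = \<delta>' \<and> push \<C> d \<delta> = pull \<C> g \<delta>''"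

definition projective :: "('o, 'm, 'k, 'e, 'z) extri_cat_scheme \<Rightarrow> 'o \<Rightarrow> bool" where
  "projective \<C> P \<longleftrightarrow> P \<in> Obj \<C> \<and>
     (\<forall>B\<in>Obj \<C>. \<forall>C\<in>Obj \<C>. \<forall>g. deflation \<C> B C g \<longrightarrow>
        (\<forall>h\<in>mor \<C> P C. \<exists>u\<in>mor \<C> P B. g \<cdot>\<^bsub>\<C>\<^esub> u = h))"

definition injective :: "('o, 'm, 'k, 'e, 'z) extri_cat_scheme \<Rightarrow> 'o \<Rightarrow> bool" where
  "injective \<C> I \<longleftrightarrow> I \<in> Obj \<C> \<and>
     (\<forall>A\<in>Obj \<C>. \<forall>B\<in>Obj \<C>. \<forall>f. inflation \<C> A B f \<longrightarrow>
        (\<forall>h\<in>mor \<C> A I. \<exists>u\<in>mor \<C> B I. u \<cdot>\<^bsub>\<C>\<^esub> f = h))"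

definition projective_injectives :: "('o, 'm, 'k, 'e, 'z) extri_cat_scheme \<Rightarrow> 'o set" where
  "projective_injectives \<C> = {P. projective \<C> P \<and> injective \<C> P}"

locale frobenius_category = extriangulated_category +
  assumes enough_projectives: "X \<in> Obj \<C> \<Longrightarrow> \<exists>P g. projective \<C> P \<and> deflation \<C> P X g"
    and enough_injectives: "X \<in> Obj \<C> \<Longrightarrow> \<exists>I f. injective \<C> I \<and> inflation \<C> X I f"
    and projective_iff_injective: "X \<in> Obj \<C> \<Longrightarrow> projective \<C> X \<longleftrightarrow> injective \<C> X"

definition right_perp :: "('o, 'm, 'k, 'e, 'z) extri_cat_scheme \<Rightarrow> 'o set \<Rightarrow> 'o set" where
  "right_perp \<C> \<X> = {Y \<in> Obj \<C>. \<forall>X\<in>\<X>. ext \<C> X Y = {\<zero>\<^bsub>Ext \<C> X Y\<^esub>}}"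

definition left_perp :: "('o, 'm, 'k, 'e, 'z) extri_cat_scheme \<Rightarrow> 'o set \<Rightarrow> 'o set" where
  "left_perp \<C> \<X> = {Y \<in> Obj \<C>. \<forall>X\<in>\<X>. ext \<C> Y X = {\<zero>\<^bsub>Ext \<C> Y X\<^esub>}}"

definition rigid :: "('o, 'm, 'k, 'e, 'z) extri_cat_scheme \<Rightarrow> 'o set \<Rightarrow> bool" where
  "rigid \<C> \<X> \<longleftrightarrow> \<X> \<subseteq> right_perp \<C> \<X>"

text \<open>
  The full subcategory on \<open>\<D>\<close> with \<open>\<bbbE>\<close> and the realisation restricted to it. If \<open>\<D>\<close> is
  extension-closed, the condition \<open>B \<in> \<D>\<close> on the middle term holds automatically.
\<close>

definition full_subcategory ::
  "('o, 'm, 'k, 'e, 'z) extri_cat_scheme \<Rightarrow> 'o set \<Rightarrow> ('o, 'm, 'k, 'e, 'z) extri_cat_scheme" where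
  "full_subcategory \<C> \<D> =
     \<C>\<lparr>Obj := \<D>, realis := (\<lambda>C A \<delta>. {(B, x, y) \<in> realis \<C> C A \<delta>. B \<in> \<D>})\<rparr>"

end

theory Submission
  imports Defs
begin

text \<open>
  Let \<open>\<N> = \<X>\<^sup>\<bottom>\<^sup>1 = \<^sup>\<bottom>\<^sup>1\<X>\<close>; it is extension-closed because \<open>\<bbbE>(X, -)\<close> is half exact. Its projectives are the
  \<open>Y\<close> with \<open>\<bbbE>(Y, \<N>) = 0\<close> and its injectives those with \<open>\<bbbE>(\<N>, Y) = 0\<close>, so every object of
  \<open>add(\<X>, \<P>)\<close> is both. For \<open>A \<in> \<N>\<close> take a right \<open>\<X>\<close>-approximation \<open>f : X \<rightarrow> A\<close> and a deflation
  \<open>g : P \<rightarrow> A\<close> with \<open>P\<close> projective. Then \<open>(f, g) : X \<oplus> P \<rightarrow> A\<close> is a deflation, and its kernel \<open>E\<close>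
  is again in \<open>\<N>\<close>: every map from \<open>\<X>\<close> to \<open>A\<close> factors through \<open>f\<close> and \<open>\<bbbE>(\<X>, X \<oplus> P) = 0\<close>, so
  \<open>\<bbbE>(\<X>, E) = 0\<close>. If \<open>A\<close> is projective in \<open>\<N>\<close> this deflation splits, so \<open>A \<in> add(\<X>, \<P>)\<close>. The
  statements about injectives are these ones in the opposite category. A kernel of a retraction is a
  direct summand, and \<open>\<N>\<close> is closed under direct summands.
\<close>

section \<open>Linear categories\<close>

text \<open>Composition is not indexed by objects, so every category axiom carries its endpoints as
  side conditions. One \<open>arr\<close> fact discharges all of them and fixes the endpoints by
  unification.\<close>

definition arr :: "('o, 'm, 'k, 'z) linear_cat_scheme \<Rightarrow> 'm \<Rightarrow> 'o \<Rightarrow> 'o \<Rightarrow> bool" where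
  "arr \<C> f A B \<longleftrightarrow> A \<in> Obj \<C> \<and> B \<in> Obj \<C> \<and> f \<in> mor \<C> A B"

context linear_category
begin

section \<open>Arithmetic of morphisms\<close>

lemma arr_Obj: "arr \<C> f A B \<Longrightarrow> A \<in> Obj \<C>" "arr \<C> f A B \<Longrightarrow> B \<in> Obj \<C>"
  and arr_mor: "arr \<C> f A B \<Longrightarrow> f \<in> mor \<C> A B"
  and arrI: "\<lbrakk>A \<in> Obj \<C>; B \<in> Obj \<C>; f \<in> mor \<C> A B\<rbrakk> \<Longrightarrow> arr \<C> f A B"
  by (auto simp: arr_def)

lemma Hom_group: "\<lbrakk>A \<in> Obj \<C>; B \<in> Obj \<C>\<rbrakk> \<Longrightarrow> abelian_group (Hom \<C> A B)"
  using Hom_module unfolding module_def by blast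

lemma arr_Comp [intro]: "\<lbrakk>arr \<C> g B C; arr \<C> f A B\<rbrakk> \<Longrightarrow> arr \<C> (g \<cdot> f) A C"
  using Comp_in by (auto simp: arr_def)

lemma arr_Id [intro]: "A \<in> Obj \<C> \<Longrightarrow> arr \<C> (Id \<C> A) A A"
  using Id_in by (auto simp: arr_def)

lemma arr_add [intro]:
  "\<lbrakk>arr \<C> f A B; arr \<C> g A B\<rbrakk> \<Longrightarrow> arr \<C> (f \<oplus>\<^bsub>Hom \<C> A B\<^esub> g) A B"
  using Hom_group abelian_monoid.a_closed abelian_group.axioms(1) by (fastforce simp: arr_def)

lemma arr_minus [intro]: "arr \<C> f A B \<Longrightarrow> arr \<C> (\<ominus>\<^bsub>Hom \<C> A B\<^esub> f) A B"
  using Hom_group abelian_group.a_inv_closed by (fastforce simp: arr_def)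

lemma arr_zero [intro]: "\<lbrakk>A \<in> Obj \<C>; B \<in> Obj \<C>\<rbrakk> \<Longrightarrow> arr \<C> (\<zero>\<^bsub>Hom \<C> A B\<^esub>) A B"
  using Hom_group abelian_monoid.zero_closed abelian_group.axioms(1) by (fastforce simp: arr_def)

lemma add_simps:
  assumes "arr \<C> f A B"
  shows "f \<oplus>\<^bsub>Hom \<C> A B\<^esub> \<zero>\<^bsub>Hom \<C> A B\<^esub> = f" "\<zero>\<^bsub>Hom \<C> A B\<^esub> \<oplus>\<^bsub>Hom \<C> A B\<^esub> f = f"
    "f \<oplus>\<^bsub>Hom \<C> A B\<^esub> (\<ominus>\<^bsub>Hom \<C> A B\<^esub> f) = \<zero>\<^bsub>Hom \<C> A B\<^esub>"
    "(\<ominus>\<^bsub>Hom \<C> A B\<^esub> f) \<oplus>\<^bsub>Hom \<C> A B\<^esub> f = \<zero>\<^bsub>Hom \<C> A B\<^esub>"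
proof -
  interpret H: abelian_group "Hom \<C> A B" using assms Hom_group by (auto simp: arr_def)
  have f: "f \<in> mor \<C> A B" using assms by (simp add: arr_def)
  show "f \<oplus>\<^bsub>Hom \<C> A B\<^esub> \<zero>\<^bsub>Hom \<C> A B\<^esub> = f" "\<zero>\<^bsub>Hom \<C> A B\<^esub> \<oplus>\<^bsub>Hom \<C> A B\<^esub> f = f"
    "f \<oplus>\<^bsub>Hom \<C> A B\<^esub> (\<ominus>\<^bsub>Hom \<C> A B\<^esub> f) = \<zero>\<^bsub>Hom \<C> A B\<^esub>"
    "(\<ominus>\<^bsub>Hom \<C> A B\<^esub> f) \<oplus>\<^bsub>Hom \<C> A B\<^esub> f = \<zero>\<^bsub>Hom \<C> A B\<^esub>"
    using f by (simp_all add: H.r_neg H.l_neg)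
qed

lemma add_comm:
  assumes "arr \<C> f A B" "arr \<C> g A B"
  shows "f \<oplus>\<^bsub>Hom \<C> A B\<^esub> g = g \<oplus>\<^bsub>Hom \<C> A B\<^esub> f"
proof -
  interpret H: abelian_group "Hom \<C> A B" using assms Hom_group by (auto simp: arr_def)
  show ?thesis using assms H.a_comm by (simp add: arr_def)
qed

lemma add_assoc:
  assumes "arr \<C> f A B" "arr \<C> g A B" "arr \<C> h A B"
  shows "(f \<oplus>\<^bsub>Hom \<C> A B\<^esub> g) \<oplus>\<^bsub>Hom \<C> A B\<^esub> h = f \<oplus>\<^bsub>Hom \<C> A B\<^esub> (g \<oplus>\<^bsub>Hom \<C> A B\<^esub> h)"
proof -
  interpret H: abelian_group "Hom \<C> A B" using assms Hom_group by (auto simp: arr_def)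
  show ?thesis using assms H.a_assoc by (simp add: arr_def)
qed

text \<open>Cancellation in the Hom group. Together with biadditivity this is how composites with a
  zero morphism are seen to vanish.\<close>

lemma add_idem_zero:
  assumes "arr \<C> f A B" "f \<oplus>\<^bsub>Hom \<C> A B\<^esub> f = f"
  shows "f = \<zero>\<^bsub>Hom \<C> A B\<^esub>"
proof -
  have "f = f \<oplus>\<^bsub>Hom \<C> A B\<^esub> (f \<oplus>\<^bsub>Hom \<C> A B\<^esub> (\<ominus>\<^bsub>Hom \<C> A B\<^esub> f))"
    using assms(1) by (simp add: add_simps)
  also have "\<dots> = (f \<oplus>\<^bsub>Hom \<C> A B\<^esub> f) \<oplus>\<^bsub>Hom \<C> A B\<^esub> (\<ominus>\<^bsub>Hom \<C> A B\<^esub> f)"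
    using assms(1) add_assoc by (metis arr_minus)
  also have "\<dots> = \<zero>\<^bsub>Hom \<C> A B\<^esub>" using assms by (simp add: add_simps)
  finally show ?thesis .
qed

text \<open>The form in which inverses are moved through composition: it suffices that the sum of
  the two candidates vanishes.\<close>

lemma neg_unique:
  assumes "arr \<C> f A B" "arr \<C> g A B" "f \<oplus>\<^bsub>Hom \<C> A B\<^esub> g = \<zero>\<^bsub>Hom \<C> A B\<^esub>"
  shows "g = \<ominus>\<^bsub>Hom \<C> A B\<^esub> f"
proof -
  have "g = ((\<ominus>\<^bsub>Hom \<C> A B\<^esub> f) \<oplus>\<^bsub>Hom \<C> A B\<^esub> f) \<oplus>\<^bsub>Hom \<C> A B\<^esub> g"
    using assms by (simp add: add_simps)
  also have "\<dots> = \<ominus>\<^bsub>Hom \<C> A B\<^esub> f"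
    using assms add_assoc add_simps by (metis arr_minus)
  finally show ?thesis .
qed

lemma Comp_assoc': "\<lbrakk>arr \<C> f A B; arr \<C> g B C; arr \<C> h C D\<rbrakk> \<Longrightarrow> (h \<cdot> g) \<cdot> f = h \<cdot> (g \<cdot> f)"
  using Comp_assoc by (auto simp: arr_def)

lemma Id_simps: "arr \<C> f A B \<Longrightarrow> Id \<C> B \<cdot> f = f" "arr \<C> f A B \<Longrightarrow> f \<cdot> Id \<C> A = f"
  using Id_left Id_right by (auto simp: arr_def)

lemma Comp_add_right':
  "\<lbrakk>arr \<C> f A B; arr \<C> f' A B; arr \<C> g B C\<rbrakk>
    \<Longrightarrow> g \<cdot> (f \<oplus>\<^bsub>Hom \<C> A B\<^esub> f') = (g \<cdot> f) \<oplus>\<^bsub>Hom \<C> A C\<^esub> (g \<cdot> f')"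
  using Comp_add_right by (auto simp: arr_def)

lemma Comp_add_left':
  "\<lbrakk>arr \<C> f A B; arr \<C> g B C; arr \<C> g' B C\<rbrakk>
    \<Longrightarrow> (g \<oplus>\<^bsub>Hom \<C> B C\<^esub> g') \<cdot> f = (g \<cdot> f) \<oplus>\<^bsub>Hom \<C> A C\<^esub> (g' \<cdot> f)"
  using Comp_add_left by (auto simp: arr_def)

lemma Comp_zero_right:
  assumes "arr \<C> g B C" "A \<in> Obj \<C>"
  shows "g \<cdot> \<zero>\<^bsub>Hom \<C> A B\<^esub> = \<zero>\<^bsub>Hom \<C> A C\<^esub>"
proof (rule add_idem_zero)
  have z: "arr \<C> (\<zero>\<^bsub>Hom \<C> A B\<^esub>) A B" using assms arr_Obj by blast
  show "arr \<C> (g \<cdot> \<zero>\<^bsub>Hom \<C> A B\<^esub>) A C" using assms z by blast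
  show "g \<cdot> \<zero>\<^bsub>Hom \<C> A B\<^esub> \<oplus>\<^bsub>Hom \<C> A C\<^esub> g \<cdot> \<zero>\<^bsub>Hom \<C> A B\<^esub> = g \<cdot> \<zero>\<^bsub>Hom \<C> A B\<^esub>"
    using Comp_add_right'[OF z z assms(1)] add_simps[OF z] by simp
qed

lemma Comp_zero_left:
  assumes "arr \<C> f A B" "C \<in> Obj \<C>"
  shows "\<zero>\<^bsub>Hom \<C> B C\<^esub> \<cdot> f = \<zero>\<^bsub>Hom \<C> A C\<^esub>"
proof (rule add_idem_zero)
  have z: "arr \<C> (\<zero>\<^bsub>Hom \<C> B C\<^esub>) B C" using assms arr_Obj by blast
  show "arr \<C> (\<zero>\<^bsub>Hom \<C> B C\<^esub> \<cdot> f) A C" using assms z by blast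
  show "\<zero>\<^bsub>Hom \<C> B C\<^esub> \<cdot> f \<oplus>\<^bsub>Hom \<C> A C\<^esub> \<zero>\<^bsub>Hom \<C> B C\<^esub> \<cdot> f = \<zero>\<^bsub>Hom \<C> B C\<^esub> \<cdot> f"
    using Comp_add_left'[OF assms(1) z z] add_simps[OF z] by simp
qed

lemma Comp_minus_right:
  assumes "arr \<C> f A B" "arr \<C> g B C"
  shows "g \<cdot> (\<ominus>\<^bsub>Hom \<C> A B\<^esub> f) = \<ominus>\<^bsub>Hom \<C> A C\<^esub> (g \<cdot> f)"
  using assms Comp_add_right'[OF assms(1) arr_minus[OF assms(1)] assms(2)]
  by (intro neg_unique) (auto simp: add_simps Comp_zero_right arr_Obj)

lemma Comp_minus_left:
  assumes "arr \<C> f A B" "arr \<C> g B C"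
  shows "(\<ominus>\<^bsub>Hom \<C> B C\<^esub> g) \<cdot> f = \<ominus>\<^bsub>Hom \<C> A C\<^esub> (g \<cdot> f)"
  using assms Comp_add_left'[OF assms(1,2) arr_minus[OF assms(2)]]
  by (intro neg_unique) (auto simp: add_simps Comp_zero_left arr_Obj)

section \<open>Isomorphisms, biproducts and kernels of retractions\<close>

lemma isomorphism_sym:
  assumes "isomorphism \<C> A B b" "A \<in> Obj \<C>" "B \<in> Obj \<C>"
  obtains g where "isomorphism \<C> B A g" "g \<cdot> b = Id \<C> A" "b \<cdot> g = Id \<C> B" "arr \<C> b A B" "arr \<C> g B A"
  using assms unfolding isomorphism_def arr_def by blast

lemma biproductE:
  assumes "biproduct \<C> A B S i j p q"
  shows "arr \<C> i A S" "arr \<C> j B S" "arr \<C> p S A" "arr \<C> q S B"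
    "p \<cdot> i = Id \<C> A" "q \<cdot> j = Id \<C> B" "p \<cdot> j = \<zero>\<^bsub>Hom \<C> B A\<^esub>" "q \<cdot> i = \<zero>\<^bsub>Hom \<C> A B\<^esub>"
    "(i \<cdot> p) \<oplus>\<^bsub>Hom \<C> S S\<^esub> (j \<cdot> q) = Id \<C> S"
    "A \<in> Obj \<C>" "B \<in> Obj \<C>" "S \<in> Obj \<C>"
  using assms unfolding biproduct_def arr_def by auto

lemma biproductI:
  assumes "arr \<C> i A S" "arr \<C> j B S" "arr \<C> p S A" "arr \<C> q S B"
    "p \<cdot> i = Id \<C> A" "q \<cdot> j = Id \<C> B" "p \<cdot> j = \<zero>\<^bsub>Hom \<C> B A\<^esub>" "q \<cdot> i = \<zero>\<^bsub>Hom \<C> A B\<^esub>"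
    "(i \<cdot> p) \<oplus>\<^bsub>Hom \<C> S S\<^esub> (j \<cdot> q) = Id \<C> S"
  shows "biproduct \<C> A B S i j p q"
  using assms unfolding biproduct_def arr_def by auto

lemma biproduct_swap:
  assumes "biproduct \<C> A B S i j p q"
  shows "biproduct \<C> B A S j i q p"
proof -
  note E = biproductE[OF assms]
  have "(j \<cdot> q) \<oplus>\<^bsub>Hom \<C> S S\<^esub> (i \<cdot> p) = Id \<C> S"
    using add_comm[OF arr_Comp[OF E(2,4)] arr_Comp[OF E(1,3)]] E(9) by simp
  with E show ?thesis by (intro biproductI)
qed

lemma biproduct_iso:
  assumes bp: "biproduct \<C> A B S i j p q" and g: "arr \<C> b S T" "arr \<C> g T S"
    "g \<cdot> b = Id \<C> S" "b \<cdot> g = Id \<C> T"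
  shows "biproduct \<C> A B T (b \<cdot> i) (b \<cdot> j) (p \<cdot> g) (q \<cdot> g)"
proof (rule biproductI)
  note E = biproductE[OF bp]
  have cancel: "(u \<cdot> g) \<cdot> (b \<cdot> v) = u \<cdot> v" if "arr \<C> u S Y" "arr \<C> v X S" for u v X Y
  proof -
    have "(u \<cdot> g) \<cdot> (b \<cdot> v) = u \<cdot> (g \<cdot> (b \<cdot> v))" using that g Comp_assoc' arr_Comp by metis
    also have "g \<cdot> (b \<cdot> v) = (g \<cdot> b) \<cdot> v" using that g Comp_assoc' by metis
    finally show ?thesis using that g Id_simps by metis
  qed
  show "p \<cdot> g \<cdot> (b \<cdot> i) = Id \<C> A" "q \<cdot> g \<cdot> (b \<cdot> j) = Id \<C> B"
    "p \<cdot> g \<cdot> (b \<cdot> j) = \<zero>\<^bsub>Hom \<C> B A\<^esub>" "q \<cdot> g \<cdot> (b \<cdot> i) = \<zero>\<^bsub>Hom \<C> A B\<^esub>"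
    using E cancel by metis+
  have ip: "arr \<C> (i \<cdot> p) S S" "arr \<C> (j \<cdot> q) S S" using E by auto
  have conj: "b \<cdot> u \<cdot> (v \<cdot> g) = b \<cdot> (u \<cdot> v) \<cdot> g" if u: "arr \<C> u X S" and v: "arr \<C> v S X" for u v X
    using Comp_assoc'[OF g(2) v arr_Comp[OF g(1) u]] Comp_assoc'[OF v u g(1)] by simp
  have "b \<cdot> i \<cdot> (p \<cdot> g) \<oplus>\<^bsub>Hom \<C> T T\<^esub> b \<cdot> j \<cdot> (q \<cdot> g)
      = (b \<cdot> (i \<cdot> p) \<oplus>\<^bsub>Hom \<C> S T\<^esub> b \<cdot> (j \<cdot> q)) \<cdot> g"
    using Comp_add_left'[OF g(2) arr_Comp[OF g(1) ip(1)] arr_Comp[OF g(1) ip(2)]]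
      conj[OF E(1,3)] conj[OF E(2,4)] by simp
  also have "\<dots> = (b \<cdot> Id \<C> S) \<cdot> g"
    using Comp_add_right'[OF ip g(1)] E(9) by simp
  also have "\<dots> = Id \<C> T" using Id_simps(2)[OF g(1)] g(4) by simp
  finally show "b \<cdot> i \<cdot> (p \<cdot> g) \<oplus>\<^bsub>Hom \<C> T T\<^esub> b \<cdot> j \<cdot> (q \<cdot> g) = Id \<C> T" .
qed (rule arr_Comp biproductE[OF bp] g)+

text \<open>The given biproduct transported along the automorphism 1 - jfp of \<open>S\<close>,
  whose inverse is 1 + jfp. The point is the new second projection fp + q: it makes the map (f, 1)
  from the direct sum of \<open>A\<close> and \<open>B\<close> to \<open>B\<close> a split
  deflation.\<close>

lemma biproduct_shear:
  assumes bp: "biproduct \<C> A B S i j p q" and f: "arr \<C> f A B"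
  shows "biproduct \<C> A B S (i \<oplus>\<^bsub>Hom \<C> A S\<^esub> (\<ominus>\<^bsub>Hom \<C> A S\<^esub> (j \<cdot> f))) j p
    ((f \<cdot> p) \<oplus>\<^bsub>Hom \<C> S B\<^esub> q)"
proof (rule biproductI)
  note E = biproductE[OF bp]
  have jf: "arr \<C> (j \<cdot> f) A S" and fp: "arr \<C> (f \<cdot> p) S B" using E f by auto
  have jfp: "arr \<C> (j \<cdot> f \<cdot> p) S S" "arr \<C> (i \<cdot> p) S S" "arr \<C> (j \<cdot> q) S S" using E jf by auto
  have z: "\<ominus>\<^bsub>Hom \<C> A A\<^esub> \<zero>\<^bsub>Hom \<C> A A\<^esub> = \<zero>\<^bsub>Hom \<C> A A\<^esub>"
    using E add_simps(2,3)[OF arr_zero[OF E(10,10)]] add_simps(2)[OF arr_minus[OF arr_zero[OF E(10,10)]]]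
    by simp
  have "p \<cdot> (j \<cdot> f) = \<zero>\<^bsub>Hom \<C> A A\<^esub>"
    using Comp_assoc'[OF f E(2,3)] E Comp_zero_left[OF f E(10)] by simp
  then show "p \<cdot> (i \<oplus>\<^bsub>Hom \<C> A S\<^esub> (\<ominus>\<^bsub>Hom \<C> A S\<^esub> (j \<cdot> f))) = Id \<C> A"
    using E jf z Comp_add_right'[OF E(1) arr_minus[OF jf] E(3)] Comp_minus_right[OF jf E(3)]
      add_simps(1)[OF arr_Id[OF E(10)]] by simp
  have "f \<cdot> p \<cdot> j = \<zero>\<^bsub>Hom \<C> B B\<^esub>"
    using Comp_assoc'[OF E(2,3) f] E Comp_zero_right[OF f] by simp
  then show r: "(f \<cdot> p \<oplus>\<^bsub>Hom \<C> S B\<^esub> q) \<cdot> j = Id \<C> B"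
    using Comp_add_left'[OF E(2) fp E(4)] E add_simps(2)[OF arr_Id[OF E(11)]] by simp
  have m: "arr \<C> (f \<cdot> p \<oplus>\<^bsub>Hom \<C> S B\<^esub> q) S B" using fp E by blast
  have "(f \<cdot> p) \<cdot> i = f" using Comp_assoc'[OF E(1,3) f] E Id_simps(2)[OF f] by simp
  then have "(f \<cdot> p \<oplus>\<^bsub>Hom \<C> S B\<^esub> q) \<cdot> i = f"
    using Comp_add_left'[OF E(1) fp E(4)] E add_simps(1)[OF f] by simp
  moreover have "(f \<cdot> p \<oplus>\<^bsub>Hom \<C> S B\<^esub> q) \<cdot> (j \<cdot> f) = f"
    using Comp_assoc'[OF f E(2) m] r Id_simps(1)[OF f] by simp
  ultimately show "(f \<cdot> p \<oplus>\<^bsub>Hom \<C> S B\<^esub> q) \<cdot> (i \<oplus>\<^bsub>Hom \<C> A S\<^esub> (\<ominus>\<^bsub>Hom \<C> A S\<^esub> (j \<cdot> f)))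
      = \<zero>\<^bsub>Hom \<C> A B\<^esub>"
    using Comp_add_right'[OF E(1) arr_minus[OF jf] m] Comp_minus_right[OF jf m] add_simps(3)[OF f]
    by simp
  have "(i \<oplus>\<^bsub>Hom \<C> A S\<^esub> (\<ominus>\<^bsub>Hom \<C> A S\<^esub> (j \<cdot> f))) \<cdot> p
      = i \<cdot> p \<oplus>\<^bsub>Hom \<C> S S\<^esub> (\<ominus>\<^bsub>Hom \<C> S S\<^esub> (j \<cdot> f \<cdot> p))"
    using Comp_add_left'[OF E(3) E(1) arr_minus[OF jf]] Comp_minus_left[OF E(3) jf] by simp
  moreover have "j \<cdot> (f \<cdot> p \<oplus>\<^bsub>Hom \<C> S B\<^esub> q) = j \<cdot> f \<cdot> p \<oplus>\<^bsub>Hom \<C> S S\<^esub> j \<cdot> q"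
    using Comp_add_right'[OF fp E(4) E(2)] Comp_assoc'[OF E(3) f E(2)] by simp
  \<comment> \<open>Reassociated so that jfp meets its negative and cancels, which leaves the
    original decomposition of the identity.\<close>
  moreover have "(i \<cdot> p \<oplus>\<^bsub>Hom \<C> S S\<^esub> (\<ominus>\<^bsub>Hom \<C> S S\<^esub> (j \<cdot> f \<cdot> p)))
      \<oplus>\<^bsub>Hom \<C> S S\<^esub> (j \<cdot> f \<cdot> p \<oplus>\<^bsub>Hom \<C> S S\<^esub> j \<cdot> q)
      = i \<cdot> p \<oplus>\<^bsub>Hom \<C> S S\<^esub> (((\<ominus>\<^bsub>Hom \<C> S S\<^esub> (j \<cdot> f \<cdot> p)) \<oplus>\<^bsub>Hom \<C> S S\<^esub> j \<cdot> f \<cdot> p)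
      \<oplus>\<^bsub>Hom \<C> S S\<^esub> j \<cdot> q)"
    using jfp add_assoc arr_minus arr_add by metis
  ultimately show "(i \<oplus>\<^bsub>Hom \<C> A S\<^esub> (\<ominus>\<^bsub>Hom \<C> A S\<^esub> (j \<cdot> f))) \<cdot> p
      \<oplus>\<^bsub>Hom \<C> S S\<^esub> j \<cdot> (f \<cdot> p \<oplus>\<^bsub>Hom \<C> S B\<^esub> q) = Id \<C> S"
    using E jfp by (simp add: add_simps)
qed (rule biproductE[OF bp] f arr_add arr_minus arr_Comp)+

lemma zero_object_arr_unique:
  assumes "zero_object \<C> Z" "A \<in> Obj \<C>"
  shows "f \<in> mor \<C> Z A \<Longrightarrow> g \<in> mor \<C> Z A \<Longrightarrow> f = g"
    and "f \<in> mor \<C> A Z \<Longrightarrow> g \<in> mor \<C> A Z \<Longrightarrow> f = g"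
  using assms unfolding zero_object_def by - (blast, blast)

lemma biproduct_zero_object:
  assumes Z: "zero_object \<C> Z" and X: "X \<in> Obj \<C>"
  shows "biproduct \<C> Z X X (\<zero>\<^bsub>Hom \<C> Z X\<^esub>) (Id \<C> X) (\<zero>\<^bsub>Hom \<C> X Z\<^esub>) (Id \<C> X)"
proof -
  have ZO: "Z \<in> Obj \<C>" using Z by (simp add: zero_object_def)
  note a = arr_zero[OF ZO X] arr_zero[OF X ZO] arr_Id[OF X] arr_Id[OF ZO]
  show ?thesis
  proof (rule biproductI)
    \<comment> \<open>Both sides are endomorphisms of a zero object, of which there is only
      one.\<close>
    show "\<zero>\<^bsub>Hom \<C> X Z\<^esub> \<cdot> \<zero>\<^bsub>Hom \<C> Z X\<^esub> = Id \<C> Z"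
      by (rule zero_object_arr_unique(1)[OF Z ZO arr_mor[OF arr_Comp[OF a(2,1)]] arr_mor[OF a(4)]])
  qed (use a ZO X in \<open>simp_all add: Id_simps Comp_zero_left[OF a(2)] add_simps\<close>)
qed

lemma direct_sum_swap: "direct_sum \<C> A B S \<Longrightarrow> direct_sum \<C> B A S"
  using biproduct_swap unfolding direct_sum_def by blast

text \<open>The idempotent 1 - sr is killed by \<open>r\<close>, hence factors through the kernel as
  nu. This \<open>u\<close> is the projection onto \<open>N\<close> that complements
  \<open>r\<close>; its identities follow because \<open>n\<close> can be cancelled on the
  left.\<close>

lemma kernel_of_retraction_summand:
  assumes r: "arr \<C> r A B" and s: "arr \<C> s B A" and rs: "r \<cdot> s = Id \<C> B"
    and k: "is_kernel \<C> A B r N n"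
  shows "direct_sum \<C> N B A"
proof -
  have A: "A \<in> Obj \<C>" "B \<in> Obj \<C>" "N \<in> Obj \<C>" and n: "arr \<C> n N A" and rn: "r \<cdot> n = \<zero>\<^bsub>Hom \<C> N B\<^esub>"
    using arr_Obj[OF r] k unfolding is_kernel_def arr_def by simp_all
  have univ: "\<exists>!u. u \<in> mor \<C> T N \<and> n \<cdot> u = t" if "arr \<C> t T A" "r \<cdot> t = \<zero>\<^bsub>Hom \<C> T B\<^esub>" for t T
    using k that unfolding is_kernel_def arr_def by simp
  define e where "e = Id \<C> A \<oplus>\<^bsub>Hom \<C> A A\<^esub> (\<ominus>\<^bsub>Hom \<C> A A\<^esub> (s \<cdot> r))"
  have sr: "arr \<C> (s \<cdot> r) A A" using r s by blast
  have e: "arr \<C> e A A" unfolding e_def using sr A by blast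
  have comp_e: "e \<cdot> t = t \<oplus>\<^bsub>Hom \<C> T A\<^esub> (\<ominus>\<^bsub>Hom \<C> T A\<^esub> (s \<cdot> (r \<cdot> t)))" if "arr \<C> t T A" for t T
    unfolding e_def using Comp_add_left'[OF that arr_Id[OF A(1)] arr_minus[OF sr]]
      Comp_minus_left[OF that sr] Comp_assoc'[OF that r s] Id_simps(1)[OF that] by simp
  have "r \<cdot> e = r \<oplus>\<^bsub>Hom \<C> A B\<^esub> (\<ominus>\<^bsub>Hom \<C> A B\<^esub> (r \<cdot> (s \<cdot> r)))"
    unfolding e_def using Comp_add_right'[OF arr_Id[OF A(1)] arr_minus[OF sr] r]
      Comp_minus_right[OF sr r] Id_simps(2)[OF r] by simp
  also have "\<dots> = \<zero>\<^bsub>Hom \<C> A B\<^esub>"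
    using Comp_assoc'[OF r s r] rs Id_simps(1)[OF r] add_simps(3)[OF r] by simp
  finally obtain u where u: "arr \<C> u A N" "n \<cdot> u = e" using univ[OF e] A arrI by blast
  have nz: "arr \<C> (\<zero>\<^bsub>Hom \<C> T A\<^esub>) T A" "\<ominus>\<^bsub>Hom \<C> T A\<^esub> \<zero>\<^bsub>Hom \<C> T A\<^esub> = \<zero>\<^bsub>Hom \<C> T A\<^esub>" if "T \<in> Obj \<C>" for T
    using that A neg_unique[OF arr_zero arr_zero, of T A] add_simps(1)[OF arr_zero, of T A] by auto
  have "n \<cdot> (u \<cdot> n) = n"
    using Comp_assoc'[OF n u(1) n] u(2) comp_e[OF n] rn Comp_zero_right[OF s A(3)] nz[OF A(3)]
      add_simps(1)[OF n] by simp
  \<comment> \<open>Both u n and the identity of \<open>N\<close> solve the factorisation problem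
    for \<open>n\<close>, so uniqueness identifies them. The same argument for the zero map gives
    \<open>us\<close>.\<close>
  then have un: "u \<cdot> n = Id \<C> N"
    using univ[OF n rn] Id_simps(2)[OF n] arr_Id[OF A(3)] arr_Comp[OF u(1) n] arr_mor by metis
  have "n \<cdot> (u \<cdot> s) = \<zero>\<^bsub>Hom \<C> B A\<^esub>"
    using Comp_assoc'[OF s u(1) n] u(2) comp_e[OF s] rs Id_simps(2)[OF s] add_simps(3)[OF s] by simp
  then have us: "u \<cdot> s = \<zero>\<^bsub>Hom \<C> B N\<^esub>"
    using univ[OF nz(1)[OF A(2)] Comp_zero_right[OF r A(2)]] Comp_zero_right[OF n A(2)]
      arr_Comp[OF u(1) s] arr_zero[OF A(2,3)] arr_mor by metis
  have "n \<cdot> u \<oplus>\<^bsub>Hom \<C> A A\<^esub> s \<cdot> r = Id \<C> A"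
    unfolding u(2) e_def using add_assoc[OF arr_Id[OF A(1)] arr_minus[OF sr] sr]
      add_simps(4)[OF sr] add_simps(1)[OF arr_Id[OF A(1)]] by simp
  then have "biproduct \<C> N B A n s u r"
    using n s u(1) r un rs us rn by (intro biproductI)
  then show ?thesis unfolding direct_sum_def by blast
qed

end


section \<open>Extriangulated categories and their opposites\<close>

text \<open>The middle isomorphisms contain identities and are closed under inverses and composites.
  This opens up \<open>realis_class\<close>, which describes a realisation only as a member of a
  quotient.\<close>

lemma (in linear_category) seq_equiv_equiv:
  assumes A: "A \<in> Obj \<C>" "C \<in> Obj \<C>"
  shows "equiv (sequences \<C> C A) (seq_equiv \<C> C A)"
proof (rule equivI)
  show "seq_equiv \<C> C A \<subseteq> sequences \<C> C A \<times> sequences \<C> C A"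
    unfolding seq_equiv_def by blast
  show "refl_on (sequences \<C> C A) (seq_equiv \<C> C A)"
  proof (rule refl_onI)
    fix s assume s: "s \<in> sequences \<C> C A"
    obtain B x y where B: "s = (B, x, y)" by (cases s)
    have a: "B \<in> Obj \<C>" "arr \<C> x A B" "arr \<C> y B C"
      using s A unfolding B sequences_def arr_def by simp_all
    have "isomorphism \<C> B B (Id \<C> B)"
      unfolding isomorphism_def using Id_simps(1)[OF arr_Id[OF a(1)]] Id_in[OF a(1)] by metis
    with s show "(s, s) \<in> seq_equiv \<C> C A"
      unfolding B seq_equiv_def using Id_simps(1)[OF a(2)] Id_simps(2)[OF a(3)] by blast
  qed
  show "sym (seq_equiv \<C> C A)"
  proof (rule symI)
    fix s t assume st: "(s, t) \<in> seq_equiv \<C> C A"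
    obtain B x y B' x' y' where B: "s = (B, x, y)" "t = (B', x', y')" by (cases s, cases t)
    obtain b where b: "isomorphism \<C> B B' b" "b \<cdot> x = x'" "y' \<cdot> b = y"
      and mem: "s \<in> sequences \<C> C A" "t \<in> sequences \<C> C A"
      using st unfolding B seq_equiv_def by blast
    have a: "B \<in> Obj \<C>" "B' \<in> Obj \<C>" "arr \<C> x A B" "arr \<C> y B C" "arr \<C> x' A B'" "arr \<C> y' B' C"
      using mem A unfolding B sequences_def arr_def by simp_all
    obtain g where g: "isomorphism \<C> B' B g" "g \<cdot> b = Id \<C> B" "b \<cdot> g = Id \<C> B'"
      "arr \<C> b B B'" "arr \<C> g B' B"
      using isomorphism_sym[OF b(1) a(1,2)] .
    have "g \<cdot> x' = x"
      using Comp_assoc'[OF a(3) g(4,5)] b(2) g(2) Id_simps(1)[OF a(3)] by simp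
    moreover have "y \<cdot> g = y'"
      using Comp_assoc'[OF g(5,4) a(6)] b(3) g(3) Id_simps(2)[OF a(6)] by simp
    ultimately show "(t, s) \<in> seq_equiv \<C> C A"
      using mem g(1) unfolding B seq_equiv_def by blast
  qed
  show "trans (seq_equiv \<C> C A)"
  proof (rule transI)
    fix s t u assume st: "(s, t) \<in> seq_equiv \<C> C A" and tu: "(t, u) \<in> seq_equiv \<C> C A"
    obtain B x y B' x' y' D v w where B: "s = (B, x, y)" "t = (B', x', y')" "u = (D, v, w)"
      by (cases s, cases t, cases u)
    obtain b c where b: "isomorphism \<C> B B' b" "b \<cdot> x = x'" "y' \<cdot> b = y"
      and c: "isomorphism \<C> B' D c" "c \<cdot> x' = v" "w \<cdot> c = y'"
      and mem: "s \<in> sequences \<C> C A" "t \<in> sequences \<C> C A" "u \<in> sequences \<C> C A"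
      using st tu unfolding B seq_equiv_def by blast
    have a: "B \<in> Obj \<C>" "B' \<in> Obj \<C>" "D \<in> Obj \<C>" "arr \<C> x A B" "arr \<C> w D C"
      using mem A unfolding B sequences_def arr_def by simp_all
    obtain g where g: "g \<cdot> b = Id \<C> B" "b \<cdot> g = Id \<C> B'" "arr \<C> b B B'" "arr \<C> g B' B"
      using isomorphism_sym[OF b(1) a(1,2)] .
    obtain h where h: "h \<cdot> c = Id \<C> B'" "c \<cdot> h = Id \<C> D" "arr \<C> c B' D" "arr \<C> h D B'"
      using isomorphism_sym[OF c(1) a(2,3)] .
    have "(g \<cdot> h) \<cdot> (c \<cdot> b) = Id \<C> B"
      using Comp_assoc'[OF arr_Comp[OF h(3) g(3)] h(4) g(4)] Comp_assoc'[OF g(3) h(3,4)] h(1)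
        Id_simps(1)[OF g(3)] g(1) by simp
    moreover have "(c \<cdot> b) \<cdot> (g \<cdot> h) = Id \<C> D"
      using Comp_assoc'[OF arr_Comp[OF g(4) h(4)] g(3) h(3)] Comp_assoc'[OF h(4) g(4,3)] g(2)
        Id_simps(1)[OF h(4)] h(2) by simp
    ultimately have "isomorphism \<C> B D (c \<cdot> b)"
      unfolding isomorphism_def
      using arr_mor[OF arr_Comp[OF h(3) g(3)]] arr_mor[OF arr_Comp[OF g(4) h(4)]] by blast
    moreover have "c \<cdot> b \<cdot> x = v" "w \<cdot> (c \<cdot> b) = y"
      using Comp_assoc'[OF a(4) g(3) h(3)] Comp_assoc'[OF g(3) h(3) a(5)] b c by simp_all
    ultimately show "(s, u) \<in> seq_equiv \<C> C A"
      using mem unfolding B seq_equiv_def by blast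
  qed
qed

context extriangulated_category
begin

lemma Ext_group: "\<lbrakk>C \<in> Obj \<C>; A \<in> Obj \<C>\<rbrakk> \<Longrightarrow> abelian_group (Ext \<C> C A)"
  using Ext_module unfolding module_def by blast

lemma zero_in_ext: "\<lbrakk>C \<in> Obj \<C>; A \<in> Obj \<C>\<rbrakk> \<Longrightarrow> \<zero>\<^bsub>Ext \<C> C A\<^esub> \<in> ext \<C> C A"
  by (simp add: Ext_group abelian_monoid.zero_closed abelian_group.axioms(1))

lemma ext_add_idem_zero:
  assumes "C \<in> Obj \<C>" "A \<in> Obj \<C>" "\<delta> \<in> ext \<C> C A" "\<delta> \<oplus>\<^bsub>Ext \<C> C A\<^esub> \<delta> = \<delta>"
  shows "\<delta> = \<zero>\<^bsub>Ext \<C> C A\<^esub>"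
proof -
  interpret E: abelian_group "Ext \<C> C A" using assms Ext_group by blast
  show ?thesis using assms(3,4) E.add.l_cancel_one by metis
qed

lemma ext_add_zero:
  assumes "C \<in> Obj \<C>" "A \<in> Obj \<C>"
  shows "\<zero>\<^bsub>Ext \<C> C A\<^esub> \<oplus>\<^bsub>Ext \<C> C A\<^esub> \<zero>\<^bsub>Ext \<C> C A\<^esub> = \<zero>\<^bsub>Ext \<C> C A\<^esub>"
proof -
  interpret E: abelian_group "Ext \<C> C A" using assms Ext_group by blast
  show ?thesis by simp
qed

lemma push_zero:
  assumes "arr \<C> a A B" "C \<in> Obj \<C>"
  shows "push \<C> a \<zero>\<^bsub>Ext \<C> C A\<^esub> = \<zero>\<^bsub>Ext \<C> C B\<^esub>"
proof -
  have O: "A \<in> Obj \<C>" "B \<in> Obj \<C>" "a \<in> mor \<C> A B" using assms by (simp_all add: arr_def)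
  note z = zero_in_ext[OF assms(2) O(1)]
  show ?thesis
    using push_add[OF O(1,2) assms(2) O(3) z z] ext_add_zero[OF assms(2) O(1)]
    by (intro ext_add_idem_zero push_in[OF O(1,2) assms(2) O(3) z] assms O) simp
qed

lemma pull_zero:
  assumes "arr \<C> c C' C" "A \<in> Obj \<C>"
  shows "pull \<C> c \<zero>\<^bsub>Ext \<C> C A\<^esub> = \<zero>\<^bsub>Ext \<C> C' A\<^esub>"
proof -
  have O: "C' \<in> Obj \<C>" "C \<in> Obj \<C>" "c \<in> mor \<C> C' C" using assms by (simp_all add: arr_def)
  note z = zero_in_ext[OF O(2) assms(2)]
  show ?thesis
    using pull_add[OF assms(2) O(2,1,3) z z] ext_add_zero[OF O(2) assms(2)]
    by (intro ext_add_idem_zero pull_in[OF assms(2) O(2,1,3) z] assms O) simp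
qed

lemma realis_sequences:
  "\<lbrakk>A \<in> Obj \<C>; C \<in> Obj \<C>; \<delta> \<in> ext \<C> C A; (B, x, y) \<in> realis \<C> C A \<delta>\<rbrakk>
    \<Longrightarrow> arr \<C> x A B \<and> arr \<C> y B C"
  using realis_class[of A C \<delta>] seq_equiv_equiv[of A C] Union_quotient[of "sequences \<C> C A" "seq_equiv \<C> C A"]
  unfolding arr_def sequences_def by fast

lemma conflation_arr:
  assumes "conflation \<C> A x B y C \<delta>"
  shows "arr \<C> x A B" "arr \<C> y B C" "A \<in> Obj \<C>" "B \<in> Obj \<C>" "C \<in> Obj \<C>" "\<delta> \<in> ext \<C> C A"
    "x \<in> mor \<C> A B" "y \<in> mor \<C> B C"
  using realis_sequences[of A C \<delta> B x y] assms unfolding conflation_def arr_def by simp_all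

text \<open>An equivalence class contains its representative, so the realisation of an extension is
  never empty.\<close>

lemma conflation_exists:
  assumes "A \<in> Obj \<C>" "C \<in> Obj \<C>" "\<delta> \<in> ext \<C> C A"
  obtains B x y where "conflation \<C> A x B y C \<delta>"
proof -
  obtain s where s: "s \<in> sequences \<C> C A" "realis \<C> C A \<delta> = seq_equiv \<C> C A `` {s}"
    using realis_class[OF assms] by (rule quotientE)
  then have "s \<in> realis \<C> C A \<delta>"
    using equiv_class_self[OF seq_equiv_equiv[OF assms(1,2)]] by simp
  then have "conflation \<C> A (fst (snd s)) (fst s) (snd (snd s)) C \<delta>"
    using assms by (simp add: conflation_def)
  then show thesis by (rule that)
qed

text \<open>Any member generates its class. Hence two conflations that realise the same extension
  differ by an isomorphism of middle terms.\<close>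

lemma realis_equiv:
  assumes "conflation \<C> A x B y C \<delta>"
  shows "realis \<C> C A \<delta> = seq_equiv \<C> C A `` {(B, x, y)}"
proof -
  note c = conflation_arr[OF assms]
  obtain s where s: "s \<in> sequences \<C> C A" "realis \<C> C A \<delta> = seq_equiv \<C> C A `` {s}"
    using realis_class[OF c(3,5,6)] by (rule quotientE)
  have "(B, x, y) \<in> seq_equiv \<C> C A `` {s}" using assms s unfolding conflation_def by simp
  then have "seq_equiv \<C> C A `` {s} = seq_equiv \<C> C A `` {(B, x, y)}"
    by (intro equiv_class_eq[OF seq_equiv_equiv[OF c(3,5)]]) simp
  with s(2) show ?thesis by simp
qed

text \<open>By \<open>realis_zero\<close> a direct sum realises the zero extension as well, so the
  given conflation is isomorphic to it and inherits its splitting through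
  \<open>biproduct_iso\<close>.\<close>

lemma conflation_zero_biproduct:
  assumes "conflation \<C> A x B y C \<zero>\<^bsub>Ext \<C> C A\<^esub>"
  shows "\<exists>p j. biproduct \<C> A C B x j p y"
proof -
  note c = conflation_arr[OF assms]
  obtain S i j p q where bp: "biproduct \<C> A C S i j p q"
    using ex_direct_sum[OF c(3,5)] unfolding direct_sum_def by blast
  note E = biproductE[OF bp]
  have "(S, i, q) \<in> realis \<C> C A \<zero>\<^bsub>Ext \<C> C A\<^esub>" using realis_zero[OF bp] .
  then have "conflation \<C> A i S q C \<zero>\<^bsub>Ext \<C> C A\<^esub>" using c by (simp add: conflation_def)
  then have "(B, x, y) \<in> seq_equiv \<C> C A `` {(S, i, q)}"
    using assms realis_equiv unfolding conflation_def by metis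
  then obtain b where b: "isomorphism \<C> S B b" "b \<cdot> i = x" "y \<cdot> b = q"
    unfolding seq_equiv_def by blast
  obtain g where g: "g \<cdot> b = Id \<C> S" "b \<cdot> g = Id \<C> B" "arr \<C> b S B" "arr \<C> g B S"
    using isomorphism_sym[OF b(1) E(12) c(4)] .
  have "q \<cdot> g = y"
    using Comp_assoc'[OF g(4,3) c(2)] b(3) g(2) Id_simps(2)[OF c(2)] by simp
  then show ?thesis using biproduct_iso[OF bp g(3,4,1,2)] b(2) by metis
qed

end


section \<open>The opposite extriangulated category\<close>

text \<open>A record update, so the opposite has the same type and every lemma of the locale can be
  instantiated with it. Extensions keep their elements; only the two arguments, the two actions and
  the direction of sequences are exchanged.\<close>

definition opposite ::
  "('o, 'm, 'k, 'e, 'z) extri_cat_scheme \<Rightarrow> ('o, 'm, 'k, 'e, 'z) extri_cat_scheme" where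
  "opposite \<C> = \<C>\<lparr>Hom := \<lambda>A B. Hom \<C> B A, Comp := \<lambda>g f. f \<cdot>\<^bsub>\<C>\<^esub> g,
     Ext := \<lambda>C A. Ext \<C> A C, push := pull \<C>, pull := push \<C>,
     realis := \<lambda>C A \<delta>. {(B, x, y). (B, y, x) \<in> realis \<C> A C \<delta>}\<rparr>"

lemma opposite_simps [simp]:
  "Obj (opposite \<C>) = Obj \<C>" "Hom (opposite \<C>) A B = Hom \<C> B A" "Id (opposite \<C>) = Id \<C>"
  "g \<cdot>\<^bsub>opposite \<C>\<^esub> f = f \<cdot>\<^bsub>\<C>\<^esub> g"
  "Ext (opposite \<C>) C A = Ext \<C> A C" "push (opposite \<C>) = pull \<C>" "pull (opposite \<C>) = push \<C>"
  "realis (opposite \<C>) C A \<delta> = {(B, x, y). (B, y, x) \<in> realis \<C> A C \<delta>}"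
  by (simp_all add: opposite_def)

lemma opposite_conflation [simp]:
  "conflation (opposite \<C>) A x B y C \<delta> \<longleftrightarrow> conflation \<C> C y B x A \<delta>"
  unfolding conflation_def by auto

lemma opposite_biproduct [simp]:
  "biproduct (opposite \<C>) A B S i j p q \<longleftrightarrow> biproduct \<C> A B S p q i j"
  unfolding biproduct_def by auto

lemma opposite_direct_sum [simp]: "direct_sum (opposite \<C>) A B S \<longleftrightarrow> direct_sum \<C> A B S"
  unfolding direct_sum_def by (metis opposite_biproduct)

lemma opposite_zero_object [simp]: "zero_object (opposite \<C>) Z \<longleftrightarrow> zero_object \<C> Z"
  unfolding zero_object_def by (simp, meson)

lemma opposite_arr [simp]: "arr (opposite \<C>) f A B \<longleftrightarrow> arr \<C> f B A"
  unfolding arr_def by auto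

lemma opposite_isomorphism [simp]: "isomorphism (opposite \<C>) A B f \<longleftrightarrow> isomorphism \<C> B A f"
  unfolding isomorphism_def by auto

lemma opposite_sequences [simp]:
  "(B, x, y) \<in> sequences (opposite \<C>) C A \<longleftrightarrow> (B, y, x) \<in> sequences \<C> A C"
  unfolding sequences_def by auto

lemma opposite_perp [simp]:
  "right_perp (opposite \<C>) \<X> = left_perp \<C> \<X>" "left_perp (opposite \<C>) \<X> = right_perp \<C> \<X>"
  unfolding right_perp_def left_perp_def by simp_all

lemma opposite_approximation [simp]:
  "right_approximation (opposite \<C>) \<X> A X f \<longleftrightarrow> left_approximation \<C> \<X> A X f"
  unfolding right_approximation_def left_approximation_def by simp

lemma opposite_deflation [simp]:
  "deflation (opposite \<C>) B C y \<longleftrightarrow> inflation \<C> C B y"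
  "inflation (opposite \<C>) B C y \<longleftrightarrow> deflation \<C> C B y"
  unfolding deflation_def inflation_def by (metis opposite_conflation)+

text \<open>The pair is reversed on the right because an isomorphism from \<open>B\<close> to
  \<open>B'\<close> in the opposite category is one from \<open>B'\<close> to \<open>B\<close> in
  \<open>\<C>\<close>.\<close>

lemma opposite_seq_equiv:
  "((B, x, y), (B', x', y')) \<in> seq_equiv (opposite \<C>) C A \<longleftrightarrow>
    ((B', y', x'), (B, y, x)) \<in> seq_equiv \<C> A C"
  unfolding seq_equiv_def by simp blast

context extriangulated_category
begin

lemma opposite_linear_category: "linear_category K (opposite \<C>)"
  by (intro linear_category.intro linear_category_axioms.intro)
    (simp_all add: K.field_axioms Hom_module Id_in Comp_in Id_left Id_right Comp_assoc[symmetric] Comp_add_left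
      Comp_add_right Comp_smult_left Comp_smult_right)

lemma opposite_realis_class:
  assumes "A \<in> Obj \<C>" "C \<in> Obj \<C>" "\<delta> \<in> ext \<C> A C"
  shows "realis (opposite \<C>) C A \<delta> \<in> sequences (opposite \<C>) C A // seq_equiv (opposite \<C>) C A"
proof -
  obtain B x y where c: "conflation \<C> C x B y A \<delta>"
    using conflation_exists[OF assms(2,1,3)] .
  note a = conflation_arr[OF c]
  have "realis (opposite \<C>) C A \<delta> = seq_equiv (opposite \<C>) C A `` {(B, y, x)}"
  proof (rule Set.set_eqI)
    fix t :: "'o \<times> 'm \<times> 'm"
    obtain B' x' y' where t: "t = (B', x', y')" by (cases t)
    have "t \<in> realis (opposite \<C>) C A \<delta> \<longleftrightarrow> ((B, x, y), (B', y', x')) \<in> seq_equiv \<C> A C"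
      unfolding t using realis_equiv[OF c] by simp
    \<comment> \<open>Symmetry of the relation undoes the reversal in
      \<open>opposite_seq_equiv\<close>.\<close>
    also have "\<dots> \<longleftrightarrow> ((B', y', x'), (B, x, y)) \<in> seq_equiv \<C> A C"
      using seq_equiv_equiv[OF assms(2,1)] by (meson equivE symE)
    finally show "t \<in> realis (opposite \<C>) C A \<delta> \<longleftrightarrow> t \<in> seq_equiv (opposite \<C>) C A `` {(B, y, x)}"
      unfolding t by (simp add: opposite_seq_equiv)
  qed
  moreover have "(B, y, x) \<in> sequences (opposite \<C>) C A"
    using a by (simp add: sequences_def)
  ultimately show ?thesis by (metis quotientI)
qed

text \<open>Exchanging injections with projections turns \<open>realis_sum\<close> into its own
  dual, up to bracketing and the order of \<open>push\<close> and \<open>pull\<close>; associativity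
  and \<open>push_pull\<close> account for these.\<close>

lemma opposite_realis_sum:
  assumes "conflation \<C> C y B x A \<delta>" "conflation \<C> C' y' B' x' A' \<delta>'"
    and A: "biproduct \<C> A A' SA pA qA iA jA" and B: "biproduct \<C> B B' SB pB qB iB jB"
    and C: "biproduct \<C> C C' SC pC qC iC jC"
  shows "(SB, (pB \<cdot> (y \<cdot> iC)) \<oplus>\<^bsub>Hom \<C> SC SB\<^esub> (qB \<cdot> (y' \<cdot> jC)),
      (pA \<cdot> (x \<cdot> iB)) \<oplus>\<^bsub>Hom \<C> SB SA\<^esub> (qA \<cdot> (x' \<cdot> jB)))
    \<in> realis \<C> SA SC
        (pull \<C> iA (push \<C> pC \<delta>) \<oplus>\<^bsub>Ext \<C> SA SC\<^esub> pull \<C> jA (push \<C> qC \<delta>'))"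
proof -
  note c = conflation_arr[OF assms(1)] and c' = conflation_arr[OF assms(2)]
  note A = biproductE[OF A] and B = biproductE[OF B] and C = biproductE[OF C]
  have "push \<C> pC (pull \<C> iA \<delta>) = pull \<C> iA (push \<C> pC \<delta>)"
    "push \<C> qC (pull \<C> jA \<delta>') = pull \<C> jA (push \<C> qC \<delta>')"
    using push_pull c c' A C arr_mor by (simp_all add: arr_mor)
  moreover have "pB \<cdot> y \<cdot> iC = pB \<cdot> (y \<cdot> iC)" "qB \<cdot> y' \<cdot> jC = qB \<cdot> (y' \<cdot> jC)"
    "pA \<cdot> x \<cdot> iB = pA \<cdot> (x \<cdot> iB)" "qA \<cdot> x' \<cdot> jB = qA \<cdot> (x' \<cdot> jB)"
    using Comp_assoc'[OF C(3) c(1) B(1)] Comp_assoc'[OF C(4) c'(1) B(2)]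
      Comp_assoc'[OF B(3) c(2) A(1)] Comp_assoc'[OF B(4) c'(2) A(2)] by simp_all
  ultimately show ?thesis using realis_sum[OF assms(1,2,5,4,3)] by simp
qed

text \<open>The axioms are closed under duality: \<open>ET3\<close> and \<open>ET4\<close> change
  places with \<open>ET3_op\<close> and \<open>ET4_op\<close>, the laws for \<open>push\<close> with
  those for \<open>pull\<close>, and the realisation axioms are self-dual.\<close>

lemma opposite_extriangulated: "extriangulated_category K (opposite \<C>)"
proof (intro extriangulated_category.intro additive_category.intro opposite_linear_category
    additive_category_axioms.intro extriangulated_category_axioms.intro)
  show "\<exists>Z. zero_object (opposite \<C>) Z" using ex_zero_object by simp
  show "\<exists>S. direct_sum (opposite \<C>) A B S" if "A \<in> Obj (opposite \<C>)" "B \<in> Obj (opposite \<C>)" for A B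
    using ex_direct_sum that by simp
  \<comment> \<open>A morphism from the first conflation to the second becomes one from the second
    to the first in \<open>\<C>\<close>, so the primed data come first in the instances
    below.\<close>
  fix A B C x y \<delta> A' B' C' x' y' \<delta>'
  assume c: "conflation (opposite \<C>) A x B y C \<delta>" "conflation (opposite \<C>) A' x' B' y' C' \<delta>'"
  {
    fix a c assume "a \<in> mor (opposite \<C>) A A'" "c \<in> mor (opposite \<C>) C C'"
      "push (opposite \<C>) a \<delta> = pull (opposite \<C>) c \<delta>'"
    then show "\<exists>b\<in>mor (opposite \<C>) B B'. b \<cdot>\<^bsub>opposite \<C>\<^esub> x = x' \<cdot>\<^bsub>opposite \<C>\<^esub> a
        \<and> y' \<cdot>\<^bsub>opposite \<C>\<^esub> b = c \<cdot>\<^bsub>opposite \<C>\<^esub> y"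
      using realis_morphism[of C' y' B' x' A' \<delta>' C y B x A \<delta> c a] c by (simp, metis)
  next
    fix a b assume "a \<in> mor (opposite \<C>) A A'" "b \<in> mor (opposite \<C>) B B'"
      "b \<cdot>\<^bsub>opposite \<C>\<^esub> x = x' \<cdot>\<^bsub>opposite \<C>\<^esub> a"
    then show "\<exists>c\<in>mor (opposite \<C>) C C'. c \<cdot>\<^bsub>opposite \<C>\<^esub> y = y' \<cdot>\<^bsub>opposite \<C>\<^esub> b
        \<and> push (opposite \<C>) a \<delta> = pull (opposite \<C>) c \<delta>'"
      using ET3_op[of C' y' B' x' A' \<delta>' C y B x A \<delta> b a] c by (simp, metis)
  next
    fix b c assume "b \<in> mor (opposite \<C>) B B'" "c \<in> mor (opposite \<C>) C C'"
      "c \<cdot>\<^bsub>opposite \<C>\<^esub> y = y' \<cdot>\<^bsub>opposite \<C>\<^esub> b"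
    then show "\<exists>a\<in>mor (opposite \<C>) A A'. b \<cdot>\<^bsub>opposite \<C>\<^esub> x = x' \<cdot>\<^bsub>opposite \<C>\<^esub> a
        \<and> push (opposite \<C>) a \<delta> = pull (opposite \<C>) c \<delta>'"
      using ET3[of C' y' B' x' A' \<delta>' C y B x A \<delta> c b] c by (simp, metis)
  }
next
  fix A f B f' D \<delta> g C g' F \<delta>'
  assume "conflation (opposite \<C>) A f B f' D \<delta>" "conflation (opposite \<C>) B g C g' F \<delta>'"
  then show "\<exists>E d e h' \<delta>''. conflation (opposite \<C>) A (g \<cdot>\<^bsub>opposite \<C>\<^esub> f) C h' E \<delta>'' \<and>
      conflation (opposite \<C>) D d E e F (push (opposite \<C>) f' \<delta>') \<and>
      h' \<cdot>\<^bsub>opposite \<C>\<^esub> g = d \<cdot>\<^bsub>opposite \<C>\<^esub> f' \<and> e \<cdot>\<^bsub>opposite \<C>\<^esub> h' = g' \<and>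
      pull (opposite \<C>) d \<delta>'' = \<delta> \<and> push (opposite \<C>) f \<delta>'' = pull (opposite \<C>) e \<delta>'"
    using ET4_op[of F g' C g B \<delta>' D f' f A \<delta>] by simp metis
next
  fix D f' A f B \<delta> F g' g C \<delta>'
  assume "conflation (opposite \<C>) D f' A f B \<delta>" "conflation (opposite \<C>) F g' B g C \<delta>'"
  then show "\<exists>E d e h' \<delta>''. conflation (opposite \<C>) E h' A (g \<cdot>\<^bsub>opposite \<C>\<^esub> f) C \<delta>'' \<and>
      conflation (opposite \<C>) D d E e F (pull (opposite \<C>) g' \<delta>) \<and>
      h' \<cdot>\<^bsub>opposite \<C>\<^esub> d = f' \<and> f \<cdot>\<^bsub>opposite \<C>\<^esub> h' = g' \<cdot>\<^bsub>opposite \<C>\<^esub> e \<and>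
      push (opposite \<C>) e \<delta>'' = \<delta>' \<and> push (opposite \<C>) d \<delta> = pull (opposite \<C>) g \<delta>''"
    using ET4[of C g B g' F \<delta>' f A f' D \<delta>] by simp metis
qed (simp_all add: Ext_module push_in pull_in push_Id pull_Id push_Comp pull_Comp push_pull push_add
    pull_add push_smult pull_smult add_push add_pull smult_push smult_pull
    realis_zero[OF biproduct_swap] opposite_realis_class[simplified]
    opposite_realis_sum)

end


section \<open>Exact sequences\<close>

context extriangulated_category
begin

section \<open>Lifting criteria and exactness of Ext\<close>

lemma conflation_zero_object:
  assumes "zero_object \<C> Z" "X \<in> Obj \<C>"
  shows "conflation \<C> Z (\<zero>\<^bsub>Hom \<C> Z X\<^esub>) X (Id \<C> X) X \<zero>\<^bsub>Ext \<C> X Z\<^esub>"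
proof -
  have "Z \<in> Obj \<C>" using assms(1) by (simp add: zero_object_def)
  then show ?thesis
    using realis_zero[OF biproduct_zero_object[OF assms]] assms(2) zero_in_ext
    by (simp add: conflation_def)
qed

text \<open>Compare the split conflation from \<open>Z\<close> through \<open>B\<close> to
  \<open>B\<close> with the given one, by the identity in the middle and \<open>y\<close> on the
  right. \<open>ET3_op\<close> then exhibits the pullback along \<open>y\<close> as a pushforward of
  zero.\<close>

lemma pull_deflation_zero:
  assumes "conflation \<C> A x B y C \<delta>"
  shows "pull \<C> y \<delta> = \<zero>\<^bsub>Ext \<C> B A\<^esub>"
proof -
  note c = conflation_arr[OF assms]
  obtain Z where Z: "zero_object \<C> Z" using ex_zero_object by blast
  have ZO: "Z \<in> Obj \<C>" using Z by (simp add: zero_object_def)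
  obtain a where "a \<in> mor \<C> Z A" "push \<C> a \<zero>\<^bsub>Ext \<C> B Z\<^esub> = pull \<C> y \<delta>"
    using ET3_op[OF conflation_zero_object[OF Z c(4)] assms Id_in[OF c(4)] c(8)] by blast
  then show ?thesis using push_zero[OF arrI[OF ZO c(3)] c(4)] by simp
qed

text \<open>Since \<open>h\<close> pulls \<delta> back to zero, the identity of \<open>A\<close> and
  \<open>h\<close> form a morphism from the split extension of \<open>X\<close> by \<open>A\<close>
  to \<delta>. \<open>realis_morphism\<close> supplies a middle map, and its restriction to the
  summand \<open>X\<close> lifts \<open>h\<close>.\<close>

lemma lift_of_pull_zero:
  assumes c: "conflation \<C> A x B y C \<delta>" and h: "arr \<C> h X C" and 0: "pull \<C> h \<delta> = \<zero>\<^bsub>Ext \<C> X A\<^esub>"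
  shows "\<exists>u\<in>mor \<C> X B. y \<cdot> u = h"
proof -
  note a = conflation_arr[OF c] and X = arr_Obj(1)[OF h]
  obtain S i j p q where bp: "biproduct \<C> A X S i j p q"
    using ex_direct_sum[OF a(3) X] unfolding direct_sum_def by blast
  note E = biproductE[OF bp]
  have s: "conflation \<C> A i S q X \<zero>\<^bsub>Ext \<C> X A\<^esub>"
    using realis_zero[OF bp] zero_in_ext a X by (simp add: conflation_def)
  have "push \<C> (Id \<C> A) \<zero>\<^bsub>Ext \<C> X A\<^esub> = pull \<C> h \<delta>"
    using push_zero[OF arr_Id[OF a(3)] X] 0 by simp
  then obtain b where b: "b \<in> mor \<C> S B" "y \<cdot> b = h \<cdot> q"
    using realis_morphism[OF s c Id_in[OF a(3)] arr_mor[OF h]] by blast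
  have b': "arr \<C> b S B" using b E a by (intro arrI)
  have "y \<cdot> (b \<cdot> j) = h"
    using Comp_assoc'[OF E(2) b' a(2)] b(2) Comp_assoc'[OF E(2,4) h] E(6) Id_simps(2)[OF h] by simp
  then show ?thesis using arr_mor[OF arr_Comp[OF b' E(2)]] by blast
qed

text \<open>The previous lemma read in the opposite category, where lifting along a deflation
  becomes extending along an inflation.\<close>

lemma extension_of_push_zero:
  assumes "conflation \<C> A x B y C \<delta>" "arr \<C> h A X" "push \<C> h \<delta> = \<zero>\<^bsub>Ext \<C> C X\<^esub>"
  shows "\<exists>u\<in>mor \<C> B X. u \<cdot> x = h"
  using extriangulated_category.lift_of_pull_zero[OF opposite_extriangulated, of C y B x A \<delta> h X] assms
  by simp

text \<open>Exactness of Hom(X, C), E(X, A), E(X, B) at the middle term. Realise \<theta> by a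
  sequence through \<open>M\<close>; as \<theta> dies under \<open>x\<close>, the map
  \<open>x\<close> extends over \<open>M\<close>, and \<open>ET3\<close> completes this to a
  morphism of conflations whose last component is \<open>h\<close>.\<close>

lemma ext_exact_left:
  assumes c: "conflation \<C> A x B y C \<delta>" and X: "X \<in> Obj \<C>" and \<theta>: "\<theta> \<in> ext \<C> X A"
    and 0: "push \<C> x \<theta> = \<zero>\<^bsub>Ext \<C> X B\<^esub>"
  shows "\<exists>h\<in>mor \<C> X C. \<theta> = pull \<C> h \<delta>"
proof -
  note a = conflation_arr[OF c]
  obtain M u v where m: "conflation \<C> A u M v X \<theta>" using conflation_exists[OF a(3) X \<theta>] .
  obtain b where "b \<in> mor \<C> M B" "b \<cdot> u = x"
    using extension_of_push_zero[OF m a(1) 0] by blast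
  then obtain h where "h \<in> mor \<C> X C" "push \<C> (Id \<C> A) \<theta> = pull \<C> h \<delta>"
    using ET3[OF m c Id_in[OF a(3)]] Id_simps(2)[OF a(1)] by metis
  then show ?thesis using push_Id[OF a(3) X \<theta>] by metis
qed

text \<open>Exactness of E(X, A), E(X, B), E(X, C) at the middle term. \<open>ET4\<close> for the
  given conflation and a realisation of \<theta> yields an extension \<open>\<delta>''\<close> of
  \<open>E\<close> by \<open>A\<close> that pushes forward to the pullback of \<theta> along
  \<open>e\<close>; a section of \<open>e\<close> brings it back over \<open>X\<close>.\<close>

lemma ext_exact_middle:
  assumes c: "conflation \<C> A x B y C \<delta>" and X: "X \<in> Obj \<C>" and \<theta>: "\<theta> \<in> ext \<C> X B"
    and 0: "push \<C> y \<theta> = \<zero>\<^bsub>Ext \<C> X C\<^esub>"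
  shows "\<exists>\<eta>\<in>ext \<C> X A. push \<C> x \<eta> = \<theta>"
proof -
  note a = conflation_arr[OF c]
  obtain M g g' where m: "conflation \<C> B g M g' X \<theta>" using conflation_exists[OF a(4) X \<theta>] .
  obtain E d e h \<delta>'' where 1: "conflation \<C> A (g \<cdot> x) M h E \<delta>''"
    and 2: "conflation \<C> C d E e X (push \<C> y \<theta>)" and 3: "push \<C> x \<delta>'' = pull \<C> e \<theta>"
    using ET4[OF c m] by blast
  note a1 = conflation_arr[OF 1] and a2 = conflation_arr[OF 2]
  \<comment> \<open>The second conflation realises the pushforward of \<theta> along
    \<open>y\<close>, which is zero, so it splits and \<open>e\<close> has a section.\<close>
  obtain j where j: "arr \<C> j X E" "e \<cdot> j = Id \<C> X"
    using conflation_zero_biproduct[OF 2[unfolded 0]] biproductE by metis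
  have "push \<C> x (pull \<C> j \<delta>'') = pull \<C> j (push \<C> x \<delta>'')"
    using push_pull[OF a(3,4) a1(5) X a(7) arr_mor[OF j(1)] a1(6)] .
  also have "\<dots> = pull \<C> (e \<cdot> j) \<theta>"
    using 3 pull_Comp[OF a(4) X a1(5) X a2(8) arr_mor[OF j(1)] \<theta>] by simp
  also have "\<dots> = \<theta>" using j pull_Id[OF a(4) X \<theta>] by simp
  finally show ?thesis using pull_in[OF a(3) a1(5) X arr_mor[OF j(1)] a1(6)] by blast
qed

section \<open>Vanishing of Ext on extensions and retracts\<close>

lemma ext_trivialI:
  assumes "X \<in> Obj \<C>" "Y \<in> Obj \<C>" "\<And>\<theta>. \<theta> \<in> ext \<C> X Y \<Longrightarrow> \<theta> = \<zero>\<^bsub>Ext \<C> X Y\<^esub>"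
  shows "ext \<C> X Y = {\<zero>\<^bsub>Ext \<C> X Y\<^esub>}"
  using assms zero_in_ext by blast

lemma ext_trivial_middle:
  assumes c: "conflation \<C> A x B y C \<delta>" and X: "X \<in> Obj \<C>"
    and "ext \<C> X A = {\<zero>\<^bsub>Ext \<C> X A\<^esub>}" "ext \<C> X C = {\<zero>\<^bsub>Ext \<C> X C\<^esub>}"
  shows "ext \<C> X B = {\<zero>\<^bsub>Ext \<C> X B\<^esub>}"
proof (rule ext_trivialI)
  note a = conflation_arr[OF c]
  fix \<theta> assume t: "\<theta> \<in> ext \<C> X B"
  have "push \<C> y \<theta> = \<zero>\<^bsub>Ext \<C> X C\<^esub>" using push_in[OF a(4,5) X a(8) t] assms(4) by blast
  then show "\<theta> = \<zero>\<^bsub>Ext \<C> X B\<^esub>"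
    using ext_exact_middle[OF c X t] assms(3) push_zero[OF a(1) X] by auto
qed (use X conflation_arr[OF c] in auto)

text \<open>By functoriality the retraction \<open>u\<close> recovers every extension from its image
  over \<open>S\<close>, where only zero is available.\<close>

lemma ext_trivial_retract_right:
  assumes n: "arr \<C> n A S" and u: "arr \<C> u S A" "u \<cdot> n = Id \<C> A" and X: "X \<in> Obj \<C>"
    and 0: "ext \<C> X S = {\<zero>\<^bsub>Ext \<C> X S\<^esub>}"
  shows "ext \<C> X A = {\<zero>\<^bsub>Ext \<C> X A\<^esub>}"
proof (rule ext_trivialI[OF X])
  note O = arr_Obj[OF n]
  fix \<theta> assume t: "\<theta> \<in> ext \<C> X A"
  have "\<theta> = push \<C> u (push \<C> n \<theta>)"
    using push_Id[OF O(1) X t] push_Comp[OF O(1,2,1) X arr_mor[OF n] arr_mor[OF u(1)] t] u(2) by simp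
  also have "push \<C> n \<theta> = \<zero>\<^bsub>Ext \<C> X S\<^esub>" using push_in[OF O X arr_mor[OF n] t] 0 by blast
  finally show "\<theta> = \<zero>\<^bsub>Ext \<C> X A\<^esub>" using push_zero[OF u(1) X] by simp
qed (use arr_Obj[OF n] in blast)

lemma ext_trivial_middle_left:
  assumes "conflation \<C> A x B y C \<delta>" "X \<in> Obj \<C>"
    "ext \<C> A X = {\<zero>\<^bsub>Ext \<C> A X\<^esub>}" "ext \<C> C X = {\<zero>\<^bsub>Ext \<C> C X\<^esub>}"
  shows "ext \<C> B X = {\<zero>\<^bsub>Ext \<C> B X\<^esub>}"
  using extriangulated_category.ext_trivial_middle[OF opposite_extriangulated, of C y B x A \<delta> X] assms
  by simp

lemma ext_trivial_retract_left:
  assumes "arr \<C> n A S" "arr \<C> u S A" "u \<cdot> n = Id \<C> A" "X \<in> Obj \<C>" "ext \<C> S X = {\<zero>\<^bsub>Ext \<C> S X\<^esub>}"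
  shows "ext \<C> A X = {\<zero>\<^bsub>Ext \<C> A X\<^esub>}"
  using extriangulated_category.ext_trivial_retract_right[OF opposite_extriangulated, of u A S n X] assms
  by simp

lemma split_conflation_direct_sum:
  assumes "conflation \<C> E h S y A \<delta>" "ext \<C> A E = {\<zero>\<^bsub>Ext \<C> A E\<^esub>}"
  shows "direct_sum \<C> E A S"
proof -
  have "\<delta> = \<zero>\<^bsub>Ext \<C> A E\<^esub>" using conflation_arr(6)[OF assms(1)] assms(2) by blast
  then show ?thesis
    using conflation_zero_biproduct[of E h S y A] assms(1) unfolding direct_sum_def by metis
qed

lemma direct_sum_conflation:
  assumes "direct_sum \<C> A B S"
  obtains x y where "conflation \<C> A x S y B \<zero>\<^bsub>Ext \<C> B A\<^esub>"
  using assms realis_zero zero_in_ext biproductE(10,11) unfolding direct_sum_def conflation_def by metis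

section \<open>Projectives and injectives through Ext\<close>

text \<open>Forwards, a section of the deflation in a realisation writes the class as a pullback of
  its pullback along that deflation, which is zero. Backwards, the obstruction to lifting
  \<open>h\<close> is the pullback of \<delta> along \<open>h\<close>, an element of a trivial
  group. The criterion mentions only Ext, so it transfers to full subcategories.\<close>

lemma projective_iff_ext:
  "projective \<C> P \<longleftrightarrow> P \<in> Obj \<C> \<and> (\<forall>A\<in>Obj \<C>. ext \<C> P A = {\<zero>\<^bsub>Ext \<C> P A\<^esub>})"
proof (intro iffI conjI ballI; (elim conjE)?)
  assume P: "projective \<C> P"
  then show PO: "P \<in> Obj \<C>" by (simp add: projective_def)
  fix A assume A: "A \<in> Obj \<C>"
  show "ext \<C> P A = {\<zero>\<^bsub>Ext \<C> P A\<^esub>}"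
  proof (rule ext_trivialI[OF PO A])
    fix \<theta> assume t: "\<theta> \<in> ext \<C> P A"
    obtain B x y where c: "conflation \<C> A x B y P \<theta>" using conflation_exists[OF A PO t] .
    note a = conflation_arr[OF c]
    have "deflation \<C> B P y" using c unfolding deflation_def by blast
    then obtain s where s: "s \<in> mor \<C> P B" "y \<cdot> s = Id \<C> P"
      using P Id_in[OF PO] a unfolding projective_def by blast
    have "\<theta> = pull \<C> s (pull \<C> y \<theta>)"
      using pull_Id[OF A PO t] pull_Comp[OF A PO a(4) PO a(8) s(1) t] s(2) by simp
    then show "\<theta> = \<zero>\<^bsub>Ext \<C> P A\<^esub>"
      using pull_deflation_zero[OF c] pull_zero[OF arrI[OF PO a(4) s(1)] A] by simp
  qed
next
  assume P: "P \<in> Obj \<C>" and e: "\<forall>A\<in>Obj \<C>. ext \<C> P A = {\<zero>\<^bsub>Ext \<C> P A\<^esub>}"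
  show "projective \<C> P" unfolding projective_def
  proof (intro conjI P ballI allI impI)
    fix B C g h assume "deflation \<C> B C g" and h: "h \<in> mor \<C> P C"
    then obtain A x \<delta> where c: "conflation \<C> A x B g C \<delta>" unfolding deflation_def by blast
    note a = conflation_arr[OF c]
    have "pull \<C> h \<delta> = \<zero>\<^bsub>Ext \<C> P A\<^esub>" using pull_in[OF a(3,5) P h a(6)] e a(3) by blast
    then show "\<exists>u\<in>mor \<C> P B. g \<cdot> u = h" using lift_of_pull_zero[OF c arrI[OF P a(5) h]] by blast
  qed
qed

lemma opposite_projective:
  "projective (opposite \<C>) P \<longleftrightarrow> injective \<C> P"
  unfolding projective_def injective_def by (simp, blast)

lemma injective_iff_ext:
  "injective \<C> P \<longleftrightarrow> P \<in> Obj \<C> \<and> (\<forall>A\<in>Obj \<C>. ext \<C> A P = {\<zero>\<^bsub>Ext \<C> A P\<^esub>})"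
  using extriangulated_category.projective_iff_ext[OF opposite_extriangulated]
  by (simp add: opposite_projective)

lemma zero_object_projective:
  assumes "zero_object \<C> Z"
  shows "projective \<C> Z"
  unfolding projective_def
proof (intro conjI ballI allI impI)
  show Z: "Z \<in> Obj \<C>" using assms by (simp add: zero_object_def)
  fix B C g h assume B: "B \<in> Obj \<C>" "C \<in> Obj \<C>" "deflation \<C> B C g" and h: "h \<in> mor \<C> Z C"
  have g: "arr \<C> g B C" using B(3) conflation_arr(2) unfolding deflation_def by blast
  have "arr \<C> (\<zero>\<^bsub>Hom \<C> Z B\<^esub>) Z B" using Z B by blast
  then show "\<exists>u\<in>mor \<C> Z B. g \<cdot> u = h"
    using zero_object_arr_unique(1)[OF assms B(2) _ h] arr_Comp[OF g] arr_mor by blast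
qed

lemma zero_object_ext:
  assumes "zero_object \<C> Z" "A \<in> Obj \<C>"
  shows "ext \<C> Z A = {\<zero>\<^bsub>Ext \<C> Z A\<^esub>}" "ext \<C> A Z = {\<zero>\<^bsub>Ext \<C> A Z\<^esub>}"
  using zero_object_projective[OF assms(1)] projective_iff_ext assms(2)
    extriangulated_category.zero_object_projective[OF opposite_extriangulated, of Z]
    opposite_projective injective_iff_ext assms by simp_all

section \<open>Perpendicular subcategories and approximations\<close>

lemma perp_summand:
  assumes "\<X> \<subseteq> Obj \<C>" "direct_sum \<C> A B S" "S \<in> right_perp \<C> \<X>"
  shows "A \<in> right_perp \<C> \<X>"
proof -
  obtain i j p q where bp: "biproduct \<C> A B S i j p q" using assms(2) unfolding direct_sum_def by blast
  note E = biproductE[OF bp]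
  show ?thesis
    using assms(3) ext_trivial_retract_right[OF E(1,3,5)] assms(1) E(10) unfolding right_perp_def by blast
qed

text \<open>Composing \<open>1 \<oplus> g\<close> with the split deflation \<open>(f, 1) : X \<oplus> A \<rightarrow> A\<close> gives the deflation \<open>(f, g)\<close>.\<close>

lemma deflation_sum:
  assumes g: "deflation \<C> P A g" and f: "arr \<C> f X A" and bp: "biproduct \<C> X P S i j p q"
  shows "deflation \<C> S A ((f \<cdot> p) \<oplus>\<^bsub>Hom \<C> S A\<^esub> (g \<cdot> q))"
proof -
  note E = biproductE[OF bp]
  obtain L k \<delta> where c: "conflation \<C> L k P g A \<delta>" using g unfolding deflation_def by blast
  note a = conflation_arr[OF c]
  obtain Z where Z: "zero_object \<C> Z" using ex_zero_object by blast
  have ZO: "Z \<in> Obj \<C>" using Z by (simp add: zero_object_def)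
  obtain L' i1 j1 p1 q1 where L: "biproduct \<C> Z L L' i1 j1 p1 q1"
    using ex_direct_sum[OF ZO a(3)] unfolding direct_sum_def by blast
  obtain T iT jT pT qT where T: "biproduct \<C> X A T iT jT pT qT"
    using ex_direct_sum[OF E(10) a(5)] unfolding direct_sum_def by blast
  note ET = biproductE[OF T]
  \<comment> \<open>\<open>?m\<close> is the direct sum of the identity of \<open>X\<close> with
    \<open>g\<close>, and \<open>?r\<close> is (f, 1).\<close>
  let ?m = "(iT \<cdot> Id \<C> X \<cdot> p) \<oplus>\<^bsub>Hom \<C> S T\<^esub> (jT \<cdot> g \<cdot> q)"
  let ?r = "(f \<cdot> pT) \<oplus>\<^bsub>Hom \<C> T A\<^esub> qT"
  \<comment> \<open>The identity of \<open>X\<close> is a deflation with kernel the zero object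
    \<open>Z\<close>. Its conflation is added to that of \<open>g\<close> by
    \<open>realis_sum\<close>, so \<open>?m\<close> has kernel the direct sum of \<open>Z\<close>
    and \<open>L\<close>.\<close>
  obtain x \<epsilon> where m: "conflation \<C> L' x S ?m T \<epsilon>"
  proof -
    let ?e = "push \<C> i1 (pull \<C> pT \<zero>\<^bsub>Ext \<C> X Z\<^esub>) \<oplus>\<^bsub>Ext \<C> T L'\<^esub> push \<C> j1 (pull \<C> qT \<delta>)"
    note EL = biproductE[OF L]
    interpret G: abelian_group "Ext \<C> T L'" using Ext_group EL ET by blast
    have "?e \<in> ext \<C> T L'"
      using push_in[OF EL(10,12) ET(12) arr_mor[OF EL(1)]
          pull_in[OF EL(10) ET(10,12) arr_mor[OF ET(3)] zero_in_ext[OF ET(10) EL(10)]]]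
        push_in[OF EL(11,12) ET(12) arr_mor[OF EL(2)]
          pull_in[OF EL(11) ET(11,12) arr_mor[OF ET(4)] a(6)]]
      by (rule G.a_closed)
    then show thesis
      using that realis_sum[OF conflation_zero_object[OF Z E(10)] c L bp T] EL ET
      unfolding conflation_def by blast
  qed
  have m': "arr \<C> ?m S T" using conflation_arr(2)[OF m] .
  \<comment> \<open>The shear makes (f, 1) a biproduct projection, hence the deflation of a split
    conflation.\<close>
  have "conflation \<C> X (iT \<oplus>\<^bsub>Hom \<C> X T\<^esub> (\<ominus>\<^bsub>Hom \<C> X T\<^esub> (jT \<cdot> f))) T ?r A \<zero>\<^bsub>Ext \<C> A X\<^esub>"
    using realis_zero[OF biproduct_shear[OF T f]] ET zero_in_ext by (simp add: conflation_def)
  then have "deflation \<C> S A (?r \<cdot> ?m)" using ET4_op[OF m] unfolding deflation_def by blast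
  moreover have "?r \<cdot> ?m = (f \<cdot> p) \<oplus>\<^bsub>Hom \<C> S A\<^esub> (g \<cdot> q)"
  proof -
    have fp: "arr \<C> (f \<cdot> pT) T A" and r: "arr \<C> ?r T A" using f ET by auto
    have gq: "arr \<C> (g \<cdot> q) S A" using a(2) E(4) by blast
    have "?r \<cdot> iT = f" using Comp_add_left'[OF ET(1) fp ET(4)] Comp_assoc'[OF ET(1,3) f] ET(5,8)
        Id_simps(2)[OF f] add_simps(1)[OF f] by simp
    moreover have "?r \<cdot> jT = Id \<C> A"
      using Comp_add_left'[OF ET(2) fp ET(4)] Comp_assoc'[OF ET(2,3) f] ET(6,7)
        Comp_zero_right[OF f a(5)] add_simps(2)[OF arr_Id[OF a(5)]] by simp
    moreover have "?m = (iT \<cdot> p) \<oplus>\<^bsub>Hom \<C> S T\<^esub> (jT \<cdot> (g \<cdot> q))"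
      using Id_simps(2)[OF ET(1)] Comp_assoc'[OF E(4) a(2) ET(2)] by simp
    moreover have "?r \<cdot> ((iT \<cdot> p) \<oplus>\<^bsub>Hom \<C> S T\<^esub> (jT \<cdot> (g \<cdot> q)))
        = (?r \<cdot> iT) \<cdot> p \<oplus>\<^bsub>Hom \<C> S A\<^esub> (?r \<cdot> jT) \<cdot> (g \<cdot> q)"
      using Comp_add_right'[OF arr_Comp[OF ET(1) E(3)] arr_Comp[OF ET(2) gq] r]
        Comp_assoc'[OF E(3) ET(1) r] Comp_assoc'[OF gq ET(2) r] by simp
    ultimately show ?thesis using Id_simps(1)[OF gq] by simp
  qed
  ultimately show ?thesis by simp
qed

text \<open>An extension of some \<open>X'\<close> in \<open>\<X>\<close> by the kernel
  \<open>E\<close> dies over \<open>S\<close>, so \<open>ext_exact_left\<close> presents it as a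
  pullback of \<delta> along a map from \<open>X'\<close> to \<open>A\<close>. That map factors
  through the approximation, hence through the deflation itself, along which \<delta> becomes
  zero.\<close>

lemma deflation_from_approximation:
  assumes \<X>: "\<X> \<subseteq> Obj \<C>" and A: "A \<in> Obj \<C>" and app: "right_approximation \<C> \<X> A X f"
    and g: "deflation \<C> P A g" and S: "direct_sum \<C> X P S" "S \<in> right_perp \<C> \<X>"
  shows "\<exists>E h y \<delta>. conflation \<C> E h S y A \<delta> \<and> E \<in> right_perp \<C> \<X>"
proof -
  obtain i j p q where bp: "biproduct \<C> X P S i j p q" using S unfolding direct_sum_def by blast
  note B = biproductE[OF bp]
  have f: "arr \<C> f X A" using app A B by (simp add: right_approximation_def arr_def)
  let ?y = "(f \<cdot> p) \<oplus>\<^bsub>Hom \<C> S A\<^esub> (g \<cdot> q)"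
  obtain E h \<delta> where c: "conflation \<C> E h S ?y A \<delta>"
    using deflation_sum[OF g f bp] unfolding deflation_def by blast
  note a = conflation_arr[OF c]
  have ga: "arr \<C> g P A" using g conflation_arr(2) unfolding deflation_def by blast
  \<comment> \<open>On the summand \<open>X\<close> the deflation is the approximation, so whatever
    factors through \<open>f\<close> factors through \<open>?y\<close>.\<close>
  have "?y \<cdot> i = f"
    using Comp_add_left'[OF B(1) arr_Comp[OF f B(3)] arr_Comp[OF ga B(4)]]
      Comp_assoc'[OF B(1,3) f] Comp_assoc'[OF B(1,4) ga] B(5,8) Id_simps(2)[OF f]
      Comp_zero_right[OF ga B(10)] add_simps(1)[OF f] by simp
  have "ext \<C> X' E = {\<zero>\<^bsub>Ext \<C> X' E\<^esub>}" if X': "X' \<in> \<X>" for X'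
  proof (rule ext_trivialI)
    show O: "X' \<in> Obj \<C>" and "E \<in> Obj \<C>" using X' \<X> a by auto
    fix \<theta> assume t: "\<theta> \<in> ext \<C> X' E"
    have "push \<C> h \<theta> = \<zero>\<^bsub>Ext \<C> X' S\<^esub>"
      using push_in[OF a(3,4) O a(7) t] S(2) X' unfolding right_perp_def by blast
    then obtain c' where c': "c' \<in> mor \<C> X' A" "\<theta> = pull \<C> c' \<delta>"
      using ext_exact_left[OF c O t] by blast
    then obtain u where u: "u \<in> mor \<C> X' X" "f \<cdot> u = c'"
      using app X' unfolding right_approximation_def by blast
    have u': "arr \<C> u X' X" using u O B by (simp add: arr_def)
    have iu: "arr \<C> (i \<cdot> u) X' S" using u' B by blast
    have "?y \<cdot> (i \<cdot> u) = c'" using Comp_assoc'[OF u' B(1) a(2)] \<open>?y \<cdot> i = f\<close> u(2) by simp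
    then have "\<theta> = pull \<C> (i \<cdot> u) (pull \<C> ?y \<delta>)"
      using c'(2) pull_Comp[OF a(3,5,4) O a(8) arr_mor[OF iu] a(6)] by simp
    then show "\<theta> = \<zero>\<^bsub>Ext \<C> X' E\<^esub>"
      using pull_deflation_zero[OF c] pull_zero[OF iu a(3)] by simp
  qed
  then show ?thesis using c a unfolding right_perp_def by blast
qed

lemma inflation_to_approximation:
  assumes "\<X> \<subseteq> Obj \<C>" "A \<in> Obj \<C>" "left_approximation \<C> \<X> A X f"
    and "inflation \<C> A I g" "direct_sum \<C> X I S" "S \<in> left_perp \<C> \<X>"
  shows "\<exists>E h y \<delta>. conflation \<C> A y S h E \<delta> \<and> E \<in> left_perp \<C> \<X>"
  using extriangulated_category.deflation_from_approximation[OF opposite_extriangulated, of \<X> A X f I g S]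
    assms by simp

end


section \<open>Extension-closed subcategories\<close>

lemma full_subcategory_simps [simp]:
  "Obj (full_subcategory \<C> \<D>) = \<D>" "Hom (full_subcategory \<C> \<D>) = Hom \<C>"
  "Id (full_subcategory \<C> \<D>) = Id \<C>" "Comp (full_subcategory \<C> \<D>) = Comp \<C>"
  "Ext (full_subcategory \<C> \<D>) = Ext \<C>" "push (full_subcategory \<C> \<D>) = push \<C>"
  "pull (full_subcategory \<C> \<D>) = pull \<C>"
  "realis (full_subcategory \<C> \<D>) C A \<delta> = {(B, x, y) \<in> realis \<C> C A \<delta>. B \<in> \<D>}"
  by (simp_all add: full_subcategory_def)

lemma full_subcategory_conflation:
  "\<D> \<subseteq> Obj \<C> \<Longrightarrow> conflation (full_subcategory \<C> \<D>) A x B y C \<delta> \<longleftrightarrow>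
    conflation \<C> A x B y C \<delta> \<and> A \<in> \<D> \<and> B \<in> \<D> \<and> C \<in> \<D>"
  unfolding conflation_def by auto

lemma full_subcategory_biproduct:
  "\<D> \<subseteq> Obj \<C> \<Longrightarrow> biproduct (full_subcategory \<C> \<D>) A B S i j p q \<longleftrightarrow>
    biproduct \<C> A B S i j p q \<and> A \<in> \<D> \<and> B \<in> \<D> \<and> S \<in> \<D>"
  unfolding biproduct_def by auto

lemma full_subcategory_isomorphism [simp]:
  "isomorphism (full_subcategory \<C> \<D>) A B f \<longleftrightarrow> isomorphism \<C> A B f"
  unfolding isomorphism_def by simp

lemma full_subcategory_sequences:
  "\<D> \<subseteq> Obj \<C> \<Longrightarrow> (B, x, y) \<in> sequences (full_subcategory \<C> \<D>) C A \<longleftrightarrow>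
    (B, x, y) \<in> sequences \<C> C A \<and> B \<in> \<D>"
  unfolding sequences_def by auto

lemma full_subcategory_seq_equiv:
  "\<D> \<subseteq> Obj \<C> \<Longrightarrow> ((B, x, y), (B', x', y')) \<in> seq_equiv (full_subcategory \<C> \<D>) C A \<longleftrightarrow>
    ((B, x, y), (B', x', y')) \<in> seq_equiv \<C> C A \<and> B \<in> \<D> \<and> B' \<in> \<D>"
  unfolding seq_equiv_def by (simp add: full_subcategory_sequences, blast)

section \<open>The inherited extriangulated structure\<close>

text \<open>Direct sums are split extensions, so closure under them is a consequence. Zero objects
  are demanded separately: the empty set is closed under extensions.\<close>

locale extension_closed = extriangulated_category +
  fixes \<D> :: "'b set"
  assumes subset_Obj: "\<D> \<subseteq> Obj \<C>"
    and zero_object_mem: "zero_object \<C> Z \<Longrightarrow> Z \<in> \<D>"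
    and extension_mem: "\<lbrakk>conflation \<C> A x B y C \<delta>; A \<in> \<D>; C \<in> \<D>\<rbrakk> \<Longrightarrow> B \<in> \<D>"
begin

lemma mem_Obj: "A \<in> \<D> \<Longrightarrow> A \<in> Obj \<C>"
  using subset_Obj by blast

abbreviation "sub \<equiv> full_subcategory \<C> \<D>"

lemmas sub_conflation = full_subcategory_conflation[OF subset_Obj]
lemmas sub_biproduct = full_subcategory_biproduct[OF subset_Obj]

lemma biproduct_mem: "\<lbrakk>biproduct \<C> A B S i j p q; A \<in> \<D>; B \<in> \<D>\<rbrakk> \<Longrightarrow> S \<in> \<D>"
  using extension_mem realis_zero zero_in_ext biproductE(10,11) unfolding conflation_def by metis

lemma sub_linear_category: "linear_category K sub"
  by (intro linear_category.intro linear_category_axioms.intro)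
    (unfold full_subcategory_simps, (((drule mem_Obj)+)?, simp add: K.field_axioms Hom_module Id_in
      Comp_in Id_left Id_right Comp_assoc Comp_add_left Comp_add_right Comp_smult_left
      Comp_smult_right)+)

text \<open>The middle term of a realisation in \<open>\<C>\<close> lies in \<open>\<D>\<close> by
  \<open>extension_mem\<close>, so the restricted class is nonempty and generated by the same
  sequence.\<close>

lemma sub_realis_class:
  assumes "A \<in> \<D>" "C \<in> \<D>" "\<delta> \<in> ext \<C> C A"
  shows "realis sub C A \<delta> \<in> sequences sub C A // seq_equiv sub C A"
proof -
  obtain B x y where c: "conflation \<C> A x B y C \<delta>"
    using conflation_exists assms mem_Obj by metis
  note a = conflation_arr[OF c]
  have B: "B \<in> \<D>" using extension_mem[OF c assms(1,2)] .
  have "realis sub C A \<delta> = seq_equiv sub C A `` {(B, x, y)}"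
    using realis_equiv[OF c] B full_subcategory_seq_equiv[OF subset_Obj] by auto
  moreover have "(B, x, y) \<in> sequences sub C A"
    using a B by (simp add: sequences_def)
  ultimately show ?thesis by (metis quotientI)
qed

text \<open>Fullness settles the axioms that only produce morphisms. Membership in
  \<open>\<D>\<close> has to be checked for zero objects, direct sums, middle terms and the object
  \<open>E\<close> of \<open>ET4\<close> and \<open>ET4_op\<close>.\<close>

lemma sub_extriangulated: "extriangulated_category K sub"
proof (intro extriangulated_category.intro additive_category.intro sub_linear_category
    additive_category_axioms.intro extriangulated_category_axioms.intro)
  obtain Z where Z: "zero_object \<C> Z" using ex_zero_object by blast
  then have "zero_object sub Z"
    using zero_object_mem[OF Z] mem_Obj unfolding zero_object_def by simp
  then show "\<exists>Z. zero_object sub Z" by blast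
  show "\<exists>S. direct_sum sub A B S" if A: "A \<in> Obj sub" and B: "B \<in> Obj sub" for A B
  proof -
    have A: "A \<in> \<D>" and B: "B \<in> \<D>" using A B by simp_all
    obtain S i j p q where bp: "biproduct \<C> A B S i j p q"
      using ex_direct_sum[OF mem_Obj[OF A] mem_Obj[OF B]] unfolding direct_sum_def by blast
    then have "biproduct sub A B S i j p q"
      using A B biproduct_mem[OF bp] by (simp add: sub_biproduct)
    then show ?thesis unfolding direct_sum_def by blast
  qed
next
  fix A f B f' D \<delta> g C g' F \<delta>'
  assume "conflation sub A f B f' D \<delta>" "conflation sub B g C g' F \<delta>'"
  then have 1: "conflation \<C> A f B f' D \<delta>" "conflation \<C> B g C g' F \<delta>'"
    and m: "A \<in> \<D>" "B \<in> \<D>" "C \<in> \<D>" "D \<in> \<D>" "F \<in> \<D>" by (simp_all add: sub_conflation)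
  obtain E d e h' \<delta>'' where c: "conflation \<C> A (g \<cdot> f) C h' E \<delta>''"
    "conflation \<C> D d E e F (push \<C> f' \<delta>')" and r: "h' \<cdot> g = d \<cdot> f'" "e \<cdot> h' = g'"
    "pull \<C> d \<delta>'' = \<delta>" "push \<C> f \<delta>'' = pull \<C> e \<delta>'"
    using ET4[OF 1] by blast
  \<comment> \<open>The second conflation of \<open>ET4\<close> displays \<open>E\<close> as an
    extension of \<open>F\<close> by \<open>D\<close>; the dual case below is the same.\<close>
  have "E \<in> \<D>" using extension_mem[OF c(2)] m by blast
  then have "conflation sub A (g \<cdot>\<^bsub>sub\<^esub> f) C h' E \<delta>''"
    "conflation sub D d E e F (push sub f' \<delta>')"
    using c m by (simp_all add: sub_conflation)
  then show "\<exists>E d e h' \<delta>''. conflation sub A (g \<cdot>\<^bsub>sub\<^esub> f) C h' E \<delta>'' \<and>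
      conflation sub D d E e F (push sub f' \<delta>') \<and> h' \<cdot>\<^bsub>sub\<^esub> g = d \<cdot>\<^bsub>sub\<^esub> f' \<and> e \<cdot>\<^bsub>sub\<^esub> h' = g' \<and>
      pull sub d \<delta>'' = \<delta> \<and> push sub f \<delta>'' = pull sub e \<delta>'"
    using r unfolding full_subcategory_simps by blast
next
  fix D f' A f B \<delta> F g' g C \<delta>'
  assume "conflation sub D f' A f B \<delta>" "conflation sub F g' B g C \<delta>'"
  then have 1: "conflation \<C> D f' A f B \<delta>" "conflation \<C> F g' B g C \<delta>'"
    and m: "A \<in> \<D>" "B \<in> \<D>" "C \<in> \<D>" "D \<in> \<D>" "F \<in> \<D>" by (simp_all add: sub_conflation)
  obtain E d e h' \<delta>'' where c: "conflation \<C> E h' A (g \<cdot> f) C \<delta>''"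
    "conflation \<C> D d E e F (pull \<C> g' \<delta>)" and r: "h' \<cdot> d = f'" "f \<cdot> h' = g' \<cdot> e"
    "push \<C> e \<delta>'' = \<delta>'" "push \<C> d \<delta> = pull \<C> g \<delta>''"
    using ET4_op[OF 1] by blast
  have "E \<in> \<D>" using extension_mem[OF c(2)] m by blast
  then have "conflation sub E h' A (g \<cdot>\<^bsub>sub\<^esub> f) C \<delta>''"
    "conflation sub D d E e F (pull sub g' \<delta>)"
    using c m by (simp_all add: sub_conflation)
  then show "\<exists>E d e h' \<delta>''. conflation sub E h' A (g \<cdot>\<^bsub>sub\<^esub> f) C \<delta>'' \<and>
      conflation sub D d E e F (pull sub g' \<delta>) \<and> h' \<cdot>\<^bsub>sub\<^esub> d = f' \<and> f \<cdot>\<^bsub>sub\<^esub> h' = g' \<cdot>\<^bsub>sub\<^esub> e \<and>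
      push sub e \<delta>'' = \<delta>' \<and> push sub d \<delta> = pull sub g \<delta>''"
    using r unfolding full_subcategory_simps by blast
next
  show "(S, i, q) \<in> realis sub C A \<zero>\<^bsub>Ext sub C A\<^esub>" if "biproduct sub A C S i j p q" for A C S i j p q
    using that realis_zero[of A C S i j p q] unfolding sub_biproduct by simp
next
  fix A x B y C \<delta> A' x' B' y' C' \<delta>' SA iA jA pA qA SB iB jB pB qB SC iC jC pC qC
  assume "conflation sub A x B y C \<delta>" "conflation sub A' x' B' y' C' \<delta>'"
    "biproduct sub A A' SA iA jA pA qA" "biproduct sub B B' SB iB jB pB qB"
    "biproduct sub C C' SC iC jC pC qC"
  then show "(SB, (iB \<cdot>\<^bsub>sub\<^esub> x \<cdot>\<^bsub>sub\<^esub> pA) \<oplus>\<^bsub>Hom sub SA SB\<^esub> (jB \<cdot>\<^bsub>sub\<^esub> x' \<cdot>\<^bsub>sub\<^esub> qA),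
        (iC \<cdot>\<^bsub>sub\<^esub> y \<cdot>\<^bsub>sub\<^esub> pB) \<oplus>\<^bsub>Hom sub SB SC\<^esub> (jC \<cdot>\<^bsub>sub\<^esub> y' \<cdot>\<^bsub>sub\<^esub> qB))
      \<in> realis sub SC SA (push sub iA (pull sub pC \<delta>) \<oplus>\<^bsub>Ext sub SC SA\<^esub>
          push sub jA (pull sub qC \<delta>'))"
    using realis_sum[of A x B y C \<delta> A' x' B' y' C' \<delta>'] unfolding sub_biproduct sub_conflation by simp
next
  show "realis sub C A \<delta> \<in> sequences sub C A // seq_equiv sub C A"
    if "A \<in> Obj sub" "C \<in> Obj sub" "\<delta> \<in> ext sub C A" for A C \<delta>
    using sub_realis_class that unfolding full_subcategory_simps(1,5) .
next
  fix A B C x y \<delta> A' B' C' x' y' \<delta>'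
  assume "conflation sub A x B y C \<delta>" "conflation sub A' x' B' y' C' \<delta>'"
  then have c: "conflation \<C> A x B y C \<delta>" "conflation \<C> A' x' B' y' C' \<delta>'"
    unfolding sub_conflation by simp_all
  {
    fix a c assume "a \<in> mor sub A A'" "c \<in> mor sub C C'" "push sub a \<delta> = pull sub c \<delta>'"
    then show "\<exists>b\<in>mor sub B B'. b \<cdot>\<^bsub>sub\<^esub> x = x' \<cdot>\<^bsub>sub\<^esub> a \<and> y' \<cdot>\<^bsub>sub\<^esub> b = c \<cdot>\<^bsub>sub\<^esub> y"
      unfolding full_subcategory_simps by (rule realis_morphism[OF c])
  next
    fix a b assume "a \<in> mor sub A A'" "b \<in> mor sub B B'" "b \<cdot>\<^bsub>sub\<^esub> x = x' \<cdot>\<^bsub>sub\<^esub> a"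
    then show "\<exists>c\<in>mor sub C C'. c \<cdot>\<^bsub>sub\<^esub> y = y' \<cdot>\<^bsub>sub\<^esub> b \<and> push sub a \<delta> = pull sub c \<delta>'"
      unfolding full_subcategory_simps by (rule ET3[OF c])
  next
    fix b c assume "b \<in> mor sub B B'" "c \<in> mor sub C C'" "c \<cdot>\<^bsub>sub\<^esub> y = y' \<cdot>\<^bsub>sub\<^esub> b"
    then show "\<exists>a\<in>mor sub A A'. b \<cdot>\<^bsub>sub\<^esub> x = x' \<cdot>\<^bsub>sub\<^esub> a \<and> push sub a \<delta> = pull sub c \<delta>'"
      unfolding full_subcategory_simps by (rule ET3_op[OF c])
  }
qed (unfold full_subcategory_simps(1-7), (((drule mem_Obj)+)?, simp add: Ext_module push_in pull_in
    push_Id pull_Id push_Comp pull_Comp push_pull push_add pull_add push_smult pull_smult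
    add_push add_pull smult_push smult_pull)+)

end

section \<open>The perpendicular category\<close>

locale rigid_approximating = frobenius_category +
  fixes \<X> :: "'b set"
  assumes X_subset: "\<X> \<subseteq> Obj \<C>"
    and X_rigid: "rigid \<C> \<X>"
    and X_finite: "functorially_finite \<C> \<X>"
    and perp_eq: "right_perp \<C> \<X> = left_perp \<C> \<X>"
begin

section \<open>Objects orthogonal to the perpendicular category on both sides\<close>

abbreviation \<N> where "\<N> \<equiv> right_perp \<C> \<X>"

text \<open>The invariant for the induction over \<open>add_closure\<close>. Membership in
  \<open>\<N>\<close> is not part of the definition, since it follows by testing against
  \<open>\<X>\<close>, which is contained in \<open>\<N>\<close>.\<close>

definition \<W> :: "'b set" where
  "\<W> = {Y \<in> Obj \<C>. \<forall>A\<in>\<N>. ext \<C> Y A = {\<zero>\<^bsub>Ext \<C> Y A\<^esub>} \<and> ext \<C> A Y = {\<zero>\<^bsub>Ext \<C> A Y\<^esub>}}"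

sublocale extension_closed K \<C> \<N>
proof
  show "\<N> \<subseteq> Obj \<C>" unfolding right_perp_def by blast
  show "Z \<in> \<N>" if "zero_object \<C> Z" for Z
  proof -
    have "Z \<in> Obj \<C>" using that by (simp add: zero_object_def)
    then show ?thesis using zero_object_ext(2)[OF that] X_subset unfolding right_perp_def by blast
  qed
  show "B \<in> \<N>" if "conflation \<C> A x B y C \<delta>" "A \<in> \<N>" "C \<in> \<N>" for A x B y C \<delta>
    using that ext_trivial_middle[OF that(1)] conflation_arr(4)[OF that(1)] X_subset
    unfolding right_perp_def by blast
qed

lemma X_subset_perp: "\<X> \<subseteq> \<N>"
  using X_rigid unfolding rigid_def .

lemma W_subset_perp: "\<W> \<subseteq> \<N>"
  unfolding \<W>_def using X_subset_perp by (auto simp: right_perp_def)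

text \<open>One vanishing is the definition of \<open>\<N>\<close>; the other is where the equality
  of the two perpendicular categories enters.\<close>

lemma X_subset_W: "\<X> \<subseteq> \<W>"
proof
  fix X assume X: "X \<in> \<X>"
  have "ext \<C> X A = {\<zero>\<^bsub>Ext \<C> X A\<^esub>}" "ext \<C> A X = {\<zero>\<^bsub>Ext \<C> A X\<^esub>}" if A: "A \<in> \<N>" for A
  proof -
    show "ext \<C> X A = {\<zero>\<^bsub>Ext \<C> X A\<^esub>}" using A X unfolding right_perp_def by blast
    have "A \<in> left_perp \<C> \<X>" using A perp_eq by blast
    then show "ext \<C> A X = {\<zero>\<^bsub>Ext \<C> A X\<^esub>}" using X unfolding left_perp_def by blast
  qed
  then show "X \<in> \<W>" unfolding \<W>_def using X X_subset by blast
qed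

text \<open>The Frobenius condition makes \<open>P\<close> injective too, so Ext vanishes in both
  arguments on all of \<open>\<C>\<close>.\<close>

lemma projective_mem_W: "projective \<C> P \<Longrightarrow> P \<in> \<W>"
  using projective_iff_injective[of P] projective_iff_ext[of P] injective_iff_ext[of P] mem_Obj
  unfolding \<W>_def by blast

lemma W_direct_sum:
  assumes "direct_sum \<C> A B S" "A \<in> \<W>" "B \<in> \<W>"
  shows "S \<in> \<W>"
proof -
  obtain x y where c: "conflation \<C> A x S y B \<zero>\<^bsub>Ext \<C> B A\<^esub>" using direct_sum_conflation[OF assms(1)] .
  show ?thesis
    unfolding \<W>_def using assms(2,3) ext_trivial_middle[OF c mem_Obj]
      ext_trivial_middle_left[OF c mem_Obj] conflation_arr(4)[OF c] by (simp add: \<W>_def)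
qed

lemma W_summand:
  assumes "direct_sum \<C> A B S" "S \<in> \<W>"
  shows "A \<in> \<W>"
proof -
  obtain i j p q where bp: "biproduct \<C> A B S i j p q" using assms(1) unfolding direct_sum_def by blast
  note E = biproductE[OF bp]
  show ?thesis
    unfolding \<W>_def using assms(2) ext_trivial_retract_right[OF E(1,3,5) mem_Obj]
      ext_trivial_retract_left[OF E(1,3,5) mem_Obj] E(10) by (simp add: \<W>_def)
qed

lemma add_closure_subset_W: "add_closure \<C> (\<X> \<union> projective_injectives \<C>) \<subseteq> \<W>"
proof
  fix Y assume "Y \<in> add_closure \<C> (\<X> \<union> projective_injectives \<C>)"
  then show "Y \<in> \<W>"
  proof induction
    case (base A)
    then show ?case using X_subset_W projective_mem_W unfolding projective_injectives_def by blast
  next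
    case (zero Z)
    then have "Z \<in> Obj \<C>" by (simp add: zero_object_def)
    then show ?case unfolding \<W>_def using zero_object_ext[OF zero] mem_Obj by blast
  next
    case sum then show ?case using W_direct_sum by blast
  next
    case summand then show ?case using W_summand by blast
  qed
qed

section \<open>Projectives and injectives of the perpendicular category\<close>

lemma sub_projective: "projective sub P \<longleftrightarrow> P \<in> \<N> \<and> (\<forall>A\<in>\<N>. ext \<C> P A = {\<zero>\<^bsub>Ext \<C> P A\<^esub>})"
  using extriangulated_category.projective_iff_ext[OF sub_extriangulated] by simp

lemma sub_injective: "injective sub P \<longleftrightarrow> P \<in> \<N> \<and> (\<forall>A\<in>\<N>. ext \<C> A P = {\<zero>\<^bsub>Ext \<C> A P\<^esub>})"
  using extriangulated_category.injective_iff_ext[OF sub_extriangulated] by simp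

abbreviation "\<A> \<equiv> add_closure \<C> (\<X> \<union> projective_injectives \<C>)"

text \<open>The two summands of \<open>S\<close> have separate tasks: \<open>P\<close> makes the map
  onto \<open>A\<close> a deflation, and the approximating object \<open>X\<close> forces its kernel
  into \<open>\<N>\<close>, so that the conflation lives in \<open>sub\<close>.\<close>

lemma enough_add_closure_projectives:
  assumes A: "A \<in> \<N>"
  shows "\<exists>E h S y \<delta>. S \<in> \<A> \<and> conflation sub E h S y A \<delta>"
proof -
  note AO = mem_Obj[OF A]
  obtain X f where app: "right_approximation \<C> \<X> A X f"
    using X_finite AO unfolding functorially_finite_def by blast
  have X: "X \<in> \<X>" using app unfolding right_approximation_def by blast
  obtain P g where P: "projective \<C> P" "deflation \<C> P A g" using enough_projectives[OF AO] by blast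
  have PO: "P \<in> Obj \<C>" "P \<in> projective_injectives \<C>"
    using P(1) projective_iff_ext projective_iff_injective[of P] unfolding projective_injectives_def by simp_all
  obtain S where S: "direct_sum \<C> X P S" using ex_direct_sum X X_subset PO(1) by blast
  have SA: "S \<in> \<A>"
    by (rule add_closure.sum[OF add_closure.base add_closure.base S]) (simp_all add: X PO(2))
  then have SN: "S \<in> \<N>" using add_closure_subset_W W_subset_perp by blast
  obtain E h y \<delta> where "conflation \<C> E h S y A \<delta>" "E \<in> \<N>"
    using deflation_from_approximation[OF X_subset AO app P(2) S SN] by blast
  then have "conflation sub E h S y A \<delta>" using SN A by (simp add: sub_conflation)
  then show ?thesis using SA by blast
qed

lemma enough_add_closure_injectives:
  assumes A: "A \<in> \<N>"
  shows "\<exists>E h S y \<delta>. S \<in> \<A> \<and> conflation sub A y S h E \<delta>"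
proof -
  note AO = mem_Obj[OF A]
  obtain X f where app: "left_approximation \<C> \<X> A X f"
    using X_finite AO unfolding functorially_finite_def by blast
  have X: "X \<in> \<X>" using app unfolding left_approximation_def by blast
  obtain I g where I: "injective \<C> I" "inflation \<C> A I g" using enough_injectives[OF AO] by blast
  have IO: "I \<in> Obj \<C>" "I \<in> projective_injectives \<C>"
    using I(1) injective_iff_ext projective_iff_injective[of I] unfolding projective_injectives_def by simp_all
  obtain S where S: "direct_sum \<C> X I S" using ex_direct_sum X X_subset IO(1) by blast
  have SA: "S \<in> \<A>"
    by (rule add_closure.sum[OF add_closure.base add_closure.base S]) (simp_all add: X IO(2))
  then have SN: "S \<in> \<N>" using add_closure_subset_W W_subset_perp by blast
  \<comment> \<open>The dual lemma speaks of the left perpendicular category, which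
    \<open>perp_eq\<close> identifies with \<open>\<N>\<close>.\<close>
  obtain E h y \<delta> where "conflation \<C> A y S h E \<delta>" "E \<in> \<N>"
    using inflation_to_approximation[OF X_subset AO app I(2) S] SN unfolding perp_eq by blast
  then have "conflation sub A y S h E \<delta>" using SN A by (simp add: sub_conflation)
  then show ?thesis using SA by blast
qed

lemma sub_projective_iff: "projective sub Y \<longleftrightarrow> Y \<in> \<A>"
proof
  assume "projective sub Y"
  then have Y: "Y \<in> \<N>" "\<And>A. A \<in> \<N> \<Longrightarrow> ext \<C> Y A = {\<zero>\<^bsub>Ext \<C> Y A\<^esub>}"
    using sub_projective by blast+
  obtain E h S y \<delta> where S: "S \<in> \<A>" and "conflation sub E h S y Y \<delta>"
    using enough_add_closure_projectives[OF Y(1)] by blast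
  then have c: "conflation \<C> E h S y Y \<delta>" "E \<in> \<N>" by (simp_all add: sub_conflation)
  \<comment> \<open>As E(Y, E) = 0, the conflation splits and \<open>Y\<close> is a summand of
    \<open>S\<close>. The swap puts \<open>Y\<close> first, the position that
    \<open>add_closure.summand\<close> extracts.\<close>
  show "Y \<in> \<A>"
    by (rule add_closure.summand[OF S direct_sum_swap[OF
      split_conflation_direct_sum[OF c(1) Y(2)[OF c(2)]]]])
next
  assume "Y \<in> \<A>"
  then have "Y \<in> \<W>" using add_closure_subset_W by blast
  then show "projective sub Y" using W_subset_perp sub_projective unfolding \<W>_def by blast
qed

lemma sub_injective_iff: "injective sub Y \<longleftrightarrow> Y \<in> \<A>"
proof
  assume "injective sub Y"
  then have Y: "Y \<in> \<N>" "\<And>A. A \<in> \<N> \<Longrightarrow> ext \<C> A Y = {\<zero>\<^bsub>Ext \<C> A Y\<^esub>}"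
    using sub_injective by blast+
  obtain E h S y \<delta> where S: "S \<in> \<A>" and "conflation sub Y y S h E \<delta>"
    using enough_add_closure_injectives[OF Y(1)] by blast
  then have c: "conflation \<C> Y y S h E \<delta>" "E \<in> \<N>" by (simp_all add: sub_conflation)
  show "Y \<in> \<A>"
    by (rule add_closure.summand[OF S split_conflation_direct_sum[OF c(1) Y(2)[OF c(2)]]])
next
  assume "Y \<in> \<A>"
  then have "Y \<in> \<W>" using add_closure_subset_W by blast
  then show "injective sub Y" using W_subset_perp sub_injective unfolding \<W>_def by blast
qed

lemma sub_frobenius: "frobenius_category K sub"
proof (intro frobenius_category.intro sub_extriangulated frobenius_category_axioms.intro)
  fix A assume A: "A \<in> Obj sub"
  show "\<exists>P g. projective sub P \<and> deflation sub P A g"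
    using enough_add_closure_projectives A sub_projective_iff unfolding deflation_def full_subcategory_simps
    by blast
  show "\<exists>I f. injective sub I \<and> inflation sub A I f"
    using enough_add_closure_injectives A sub_injective_iff unfolding inflation_def full_subcategory_simps
    by blast
  show "projective sub A \<longleftrightarrow> injective sub A" using sub_projective_iff sub_injective_iff by blast
qed

lemma sub_projective_injectives: "projective_injectives sub = \<A>"
  by (rule Set.set_eqI) (simp add: projective_injectives_def[of sub] sub_projective_iff sub_injective_iff)

text \<open>The kernel taken in \<open>\<C>\<close> is a direct summand of \<open>A\<close>, hence
  lies in \<open>\<N>\<close>; its universal property then only has to be restricted to test objects
  from \<open>\<N>\<close>.\<close>

lemma sub_weakly_idempotent_complete:
  assumes w: "weakly_idempotent_complete \<C>"
  shows "weakly_idempotent_complete sub"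
  unfolding weakly_idempotent_complete_def
proof (intro ballI allI impI)
  fix A B r assume AB: "A \<in> Obj sub" "B \<in> Obj sub" and r: "retraction sub A B r"
  have O: "A \<in> \<N>" "B \<in> \<N>" "A \<in> Obj \<C>" "B \<in> Obj \<C>" using AB mem_Obj by simp_all
  have r': "retraction \<C> A B r" using r unfolding retraction_def by simp
  obtain N n where k: "is_kernel \<C> A B r N n"
    using w r' O unfolding weakly_idempotent_complete_def by blast
  obtain s where s: "arr \<C> r A B" "arr \<C> s B A" "r \<cdot> s = Id \<C> B"
    using r' O unfolding retraction_def arr_def by blast
  have "N \<in> \<N>" using perp_summand[OF X_subset kernel_of_retraction_summand[OF s k] O(1)] .
  then have "is_kernel sub A B r N n"
    using k mem_Obj unfolding is_kernel_def full_subcategory_simps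
    by (elim conjE, intro conjI ballI impI) (assumption+, (drule bspec | drule mp | assumption)+)
  then show "\<exists>N n. is_kernel sub A B r N n" by blast
qed

end

theorem proposition3p16:
  fixes K :: "'k ring"
    and \<C> :: "('o, 'm, 'k, 'e) extri_cat"
    and \<X> :: "'o set"
  assumes "frobenius_category K \<C>"
    and "\<X> \<subseteq> Obj \<C>"
    and "rigid \<C> \<X>"
    and "functorially_finite \<C> \<X>"
    and "right_perp \<C> \<X> = left_perp \<C> \<X>"
  shows "frobenius_category K (full_subcategory \<C> (right_perp \<C> \<X>)) \<and>
    projective_injectives (full_subcategory \<C> (right_perp \<C> \<X>))
      = add_closure \<C> (\<X> \<union> projective_injectives \<C>) \<and>
    (weakly_idempotent_complete \<C> \<longrightarrow>
      weakly_idempotent_complete (full_subcategory \<C> (right_perp \<C> \<X>)))"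
proof -
  interpret rigid_approximating K \<C> \<X>
    using assms by (intro rigid_approximating.intro rigid_approximating_axioms.intro)
  show ?thesis
    by (intro conjI impI sub_frobenius sub_projective_injectives sub_weakly_idempotent_complete)
qed

end
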